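(* Let the scalar field be $\mathbb{C}$. There is a constant $C\ge1$ such that for every compact Hausdorff space $K$ and every countable ordinal $\alpha\in\omega_1$ the following holds: if the Cantor--Bendixson derived set $K^{(\alpha\odot 2)}$ satisfies $|K^{(\alpha\odot 2)}|\ge 2$, then there exists a linear isometric embedding of $C[1,\omega^\alpha]$ into $C(K)$ whose range does $C$-SPR in $C(K)$ (so there is an isometric SPR embedding of $C[1,\omega^\alpha]$ into $C(K)$, with SPR constant uniform in $\alpha$).
   Context: $C(K)$ is the space of complex-valued continuous functions on $K$ with the supremum norm. A complex linear subspace $E$ of $C(K)$ does $C$-stable phase retrieval ($C$-SPR), for a constant $C\ge1$, if $\inf_{\lambda\in\mathbb{C},|\lambda|=1}\|f-\lambda g\|\le C\,\big\||f|-|g|\big\|$ for all $f,g\in E$. Cantor--Bendixson derivatives: for a topological space $T$, $T'$ is the set of its non-isolated points; $K^{(0)}=K$, $K^{(\alpha+1)}=(K^{(\alpha)})'$ (with $K^{(\alpha)}$ in the subspace topology), and $K^{(\alpha)}=\bigcap_{\beta<\alpha}K^{(\beta)}$ for limit ordinals $\alpha$. Ordinals: $\omega_1$ is the first uncountable ordinal and ordinal powers are ordinal exponentiation. $[1,\omega^\alpha]$ is the set of ordinals $\beta$ with $1\le\beta\le\omega^\alpha$ with the order topology (a compact Hausdorff space). For ordinals $\alpha,\beta$, $\alpha\oplus\beta$ is the natural (Hessenberg) sum, i.e. the ordinal whose Cantor normal form is obtained by adding coordinatewise the coefficients of the Cantor normal forms of $\alpha$ and $\beta$; and $\alpha\odot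 2=\alpha\oplus\alpha$, i.e. if $\alpha=\omega^{\beta_1}\cdot k_1+\dots+\omega^{\beta_n}\cdot k_n$ with $\beta_1>\dots>\beta_n$ and positive integers $k_i$, then $\alpha\odot2=\omega^{\beta_1}\cdot 2k_1+\dots+\omega^{\beta_n}\cdot 2k_n$ (and $0\odot 2=0$). *)

theory Defs
  imports "HOL-Analysis.Analysis"
begin

section \<open>The countable ordinals\<close>

text \<open>The points of the library's well-order \<open>\<omega>\<^sub>1\<close>, the cardinal successor of \<open>\<omega>\<close>: the type
  consists exactly of the countable ordinals.\<close>

typedef cord = "Field (cardSuc natLeq)"
  morphisms rep_cord Abs_cord
proof -
  have "infinite (Field (cardSuc natLeq))"
    using cardSuc_finite[OF natLeq_Card_order] by (simp add: Field_natLeq)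
  then show ?thesis
    by (metis finite.emptyI ex_in_conv)
qed

lemma Well_order_omega1: "Well_order (cardSuc natLeq)"
  using cardSuc_Card_order[OF natLeq_Card_order] card_order_on_well_order_on by blast

instantiation cord :: linorder
begin

definition less_eq_cord :: "cord \<Rightarrow> cord \<Rightarrow> bool"
  where "x \<le> y \<longleftrightarrow> (rep_cord x, rep_cord y) \<in> cardSuc natLeq"

definition less_cord :: "cord \<Rightarrow> cord \<Rightarrow> bool"
  where "x < y \<longleftrightarrow> x \<le> y \<and> \<not> y \<le> (x::cord)"

instance
proof
  have W: "refl_on (Field (cardSuc natLeq)) (cardSuc natLeq)" "trans (cardSuc natLeq)"
    "antisym (cardSuc natLeq)" "total_on (Field (cardSuc natLeq)) (cardSuc natLeq)"
    using Well_order_omega1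
    unfolding well_order_on_def linear_order_on_def partial_order_on_def preorder_on_def by auto
  fix x y z :: cord
  show "(x < y) = (x \<le> y \<and> \<not> y \<le> x)"
    by (simp add: less_cord_def)
  show refl: "x \<le> x"
    using W(1) rep_cord[of x] by (auto simp: less_eq_cord_def refl_on_def)
  show "x \<le> y \<Longrightarrow> y \<le> z \<Longrightarrow> x \<le> z"
    using W(2) unfolding less_eq_cord_def by (meson transD)
  show "x \<le> y \<Longrightarrow> y \<le> x \<Longrightarrow> x = y"
    using W(3) unfolding less_eq_cord_def by (metis antisymD rep_cord_inject)
  show "x \<le> y \<or> y \<le> x"
    using W(4) rep_cord[of x] rep_cord[of y] refl rep_cord_inject
    unfolding less_eq_cord_def total_on_def by metis
qed

end

instance cord :: wellorder
proof
  fix P :: "cord \<Rightarrow> bool" and a :: cord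
  assume step: "\<And>x. (\<And>y. y < x \<Longrightarrow> P y) \<Longrightarrow> P x"
  have wf: "wf (cardSuc natLeq - Id)"
    using Well_order_omega1 unfolding well_order_on_def by blast
  have "wf (inv_image (cardSuc natLeq - Id) rep_cord)"
    using wf by (rule wf_inv_image)
  moreover have "{(x, y). x < (y::cord)} \<subseteq> inv_image (cardSuc natLeq - Id) rep_cord"
    by (auto simp: inv_image_def less_le less_eq_cord_def rep_cord_inject)
  ultimately have "wf {(x, y). x < (y::cord)}"
    by (rule wf_subset)
  then show "P a"
    by (rule wf_induct_rule) (use step in auto)
qed

instantiation cord :: conditionally_complete_linorder
begin

definition sup_cord :: "cord \<Rightarrow> cord \<Rightarrow> cord" where "sup_cord = max"
definition inf_cord :: "cord \<Rightarrow> cord \<Rightarrow> cord" where "inf_cord = min"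
definition Sup_cord :: "cord set \<Rightarrow> cord" where "Sup A = (LEAST x::cord. \<forall>a\<in>A. a \<le> x)"
definition Inf_cord :: "cord set \<Rightarrow> cord" where "Inf A = (LEAST x::cord. x \<in> A)"

instance
proof
  fix x y z :: cord and X :: "cord set"
  show "inf x y \<le> x" "inf x y \<le> y" "x \<le> y \<Longrightarrow> x \<le> z \<Longrightarrow> x \<le> inf y z"
    "x \<le> sup x y" "y \<le> sup x y" "y \<le> x \<Longrightarrow> z \<le> x \<Longrightarrow> sup y z \<le> x"
    by (auto simp: sup_cord_def inf_cord_def)
  show "x \<in> X \<Longrightarrow> bdd_below X \<Longrightarrow> Inf X \<le> x"
    by (simp add: Inf_cord_def Least_le)
  show "X \<noteq> {} \<Longrightarrow> (\<And>x. x \<in> X \<Longrightarrow> z \<le> x) \<Longrightarrow> z \<le> Inf X"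
    unfolding Inf_cord_def by (metis LeastI ex_in_conv)
  show "X \<noteq> {} \<Longrightarrow> (\<And>x. x \<in> X \<Longrightarrow> x \<le> z) \<Longrightarrow> Sup X \<le> z"
    by (simp add: Sup_cord_def Least_le)
  show "x \<le> Sup X" if "x \<in> X" "bdd_above X"
  proof -
    obtain u where "\<forall>a\<in>X. a \<le> u"
      using \<open>bdd_above X\<close> by (auto simp: bdd_above_def)
    then have "\<forall>a\<in>X. a \<le> Sup X"
      unfolding Sup_cord_def by (rule LeastI)
    then show ?thesis using \<open>x \<in> X\<close> by blast
  qed
qed

end

instantiation cord :: linorder_topology
begin

definition open_cord :: "cord set \<Rightarrow> bool"
  where "open_cord = generate_topology (range (\<lambda>a. {..<a}) \<union> range (\<lambda>a. {a<..}))"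

instance by standard (rule open_cord_def)

end

lemma countable_atMost_cord:
  includes cardinal_syntax
  shows "countable {..x::cord}"
proof -
  let ?r = "cardSuc natLeq"
  have co: "Card_order ?r"
    by (rule cardSuc_Card_order[OF natLeq_Card_order])
  have "rep_cord x \<in> Field ?r" by (rule rep_cord)
  then have "|underS ?r (rep_cord x)| <o ?r"
    by (rule card_of_underS[OF co])
  then have "|underS ?r (rep_cord x)| \<le>o natLeq"
    using cardSuc_ordLeq_ordLess[OF natLeq_Card_order card_of_Card_order] by blast
  then have "|underS ?r (rep_cord x)| \<le>o |UNIV::nat set|"
    using card_of_nat ordIso_symmetric ordLeq_ordIso_trans by blast
  then obtain f :: "nat set \<Rightarrow> nat" where "inj_on f (underS ?r (rep_cord x))"
    unfolding card_of_ordLeq[symmetric] by blast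
  then have c: "countable (underS ?r (rep_cord x))"
    by (rule countableI)
  have "rep_cord ` {..<x} \<subseteq> underS ?r (rep_cord x)"
    by (auto simp: underS_def less_le less_eq_cord_def rep_cord_inject)
  then have "countable (rep_cord ` {..<x})"
    using c countable_subset by blast
  moreover have "inj_on rep_cord {..<x}"
    by (simp add: inj_on_def rep_cord_inject)
  ultimately have "countable {..<x}"
    by (rule countable_image_inj_on)
  moreover have "{..x} = insert x {..<x}" by auto
  ultimately show ?thesis by simp
qed

lemma uncountable_cord:
  includes cardinal_syntax
  shows "uncountable (UNIV :: cord set)"
proof
  let ?r = "cardSuc natLeq"
  assume "countable (UNIV :: cord set)"
  then have "countable (range rep_cord)" by simp
  moreover have "range rep_cord = Field ?r"
    using type_definition.Rep_range[OF type_definition_cord] .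
  ultimately have "countable (Field ?r)" by simp
  then obtain f :: "nat set \<Rightarrow> nat" where "inj_on f (Field ?r)"
    by (auto simp: countable_def)
  then have "|Field ?r| \<le>o |UNIV::nat set|"
    unfolding card_of_ordLeq[symmetric] by blast
  then have "?r \<le>o natLeq"
    using card_of_nat card_of_Field_ordIso[OF cardSuc_Card_order[OF natLeq_Card_order]]
    by (meson ordIso_symmetric ordIso_ordLeq_trans ordLeq_ordIso_trans)
  then show False
    using cardSuc_greater[OF natLeq_Card_order] not_ordLess_ordLeq by blast
qed

lemma ex_greater_countable_cord:
  assumes "countable (A :: cord set)"
  shows "\<exists>x. \<forall>a\<in>A. a < x"
proof (rule ccontr)
  assume "\<not> ?thesis"
  then have "UNIV \<subseteq> (\<Union>a\<in>A. {..a})" by (force simp: not_less)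
  moreover have "countable (\<Union>a\<in>A. {..a})"
    using assms countable_atMost_cord by blast
  ultimately show False
    using uncountable_cord countable_subset by blast
qed

lemma bdd_above_countable_cord: "countable (A :: cord set) \<Longrightarrow> bdd_above A"
  using ex_greater_countable_cord[of A] by (auto simp: bdd_above_def intro: less_imp_le)

definition osucc :: "cord \<Rightarrow> cord"
  where "osucc x = (LEAST y. x < y)"

definition is_succ :: "cord \<Rightarrow> bool"
  where "is_succ x \<longleftrightarrow> (\<exists>y. x = osucc y)"

definition opred :: "cord \<Rightarrow> cord"
  where "opred x = (THE y. x = osucc y)"

lemma less_osucc: "x < osucc x"
  unfolding osucc_def by (rule LeastI_ex) (use ex_greater_countable_cord[of "{x}"] in auto)

lemma osucc_le_iff: "osucc x \<le> y \<longleftrightarrow> x < y"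
  using less_osucc[of x] by (auto simp: osucc_def intro: Least_le order.strict_trans2)

lemma osucc_inject [simp]: "osucc x = osucc y \<longleftrightarrow> x = y"
  by (metis less_osucc not_le osucc_le_iff linorder_cases)

lemma opred_osucc [simp]: "opred (osucc x) = x"
  by (simp add: opred_def)

lemma is_succ_osucc [simp]: "is_succ (osucc x)"
  by (auto simp: is_succ_def)

instantiation cord :: "{zero, one}"
begin
definition zero_cord :: cord where "0 = (LEAST x::cord. True)"
definition one_cord :: cord where "1 = osucc 0"
instance ..
end

lemma zero_le_cord [simp]: "0 \<le> (x::cord)"
  by (simp add: zero_cord_def Least_le)

lemma osucc_neq_zero [simp]: "osucc x \<noteq> 0"
  by (metis less_osucc zero_le_cord not_le)

section \<open>Transfinite recursion and ordinal arithmetic\<close>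

text \<open>\<open>ord_rec z s l\<close> is the function with value \<open>z\<close> at \<open>0\<close>, obtained by \<open>s\<close> from the preceding
  value at a successor, and by \<open>l\<close> from the set of all preceding values at a limit ordinal.\<close>

function ord_rec :: "'b \<Rightarrow> ('b \<Rightarrow> 'b) \<Rightarrow> ('b set \<Rightarrow> 'b) \<Rightarrow> cord \<Rightarrow> 'b" where
  "ord_rec z s l b =
     (if b = 0 then z
      else if is_succ b then s (ord_rec z s l (opred b))
      else l (ord_rec z s l ` {..<b}))"
  by pat_completeness auto
termination
  by (relation "inv_image {(x, y). x < y} (\<lambda>(z, s, l, b). b)")
     (auto simp: wellorder_class.wf is_succ_def less_osucc)

declare ord_rec.simps [simp del]

lemma ord_rec_zero [simp]: "ord_rec z s l 0 = z"
  by (simp add: ord_rec.simps)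

lemma ord_rec_osucc [simp]: "ord_rec z s l (osucc b) = s (ord_rec z s l b)"
  by (subst ord_rec.simps) simp

lemma ord_rec_limit: "b \<noteq> 0 \<Longrightarrow> \<not> is_succ b \<Longrightarrow> ord_rec z s l b = l (ord_rec z s l ` {..<b})"
  by (subst ord_rec.simps) simp

instantiation cord :: "{plus, times}"
begin
definition plus_cord :: "cord \<Rightarrow> cord \<Rightarrow> cord"
  where "a + b = ord_rec a osucc Sup b"
definition times_cord :: "cord \<Rightarrow> cord \<Rightarrow> cord"
  where "a * b = ord_rec 0 (\<lambda>x. x + a) Sup b"
instance ..
end

lemma plus_cord_simps:
  "a + 0 = (a::cord)" "a + osucc b = osucc (a + b)"
  "b \<noteq> 0 \<Longrightarrow> \<not> is_succ b \<Longrightarrow> a + b = (SUP x\<in>{..<b}. a + x)"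
  by (simp_all add: plus_cord_def ord_rec_limit)

lemma times_cord_simps:
  "a * 0 = (0::cord)" "a * osucc b = a * b + a"
  "b \<noteq> 0 \<Longrightarrow> \<not> is_succ b \<Longrightarrow> a * b = (SUP x\<in>{..<b}. a * x)"
  by (simp_all add: times_cord_def ord_rec_limit)

definition omega :: cord
  where "omega = (LEAST x. x \<noteq> 0 \<and> \<not> is_succ x)"

definition omega_pow :: "cord \<Rightarrow> cord"
  where "omega_pow b = ord_rec 1 (\<lambda>x. x * omega) Sup b"

lemma omega_pow_simps:
  "omega_pow 0 = 1" "omega_pow (osucc b) = omega_pow b * omega"
  "b \<noteq> 0 \<Longrightarrow> \<not> is_succ b \<Longrightarrow> omega_pow b = (SUP x\<in>{..<b}. omega_pow x)"
  by (simp_all add: omega_pow_def ord_rec_limit)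

definition ord_of_nat :: "nat \<Rightarrow> cord"
  where "ord_of_nat n = (osucc ^^ n) 0"

section \<open>Cantor normal form and natural sum\<close>

text \<open>A Cantor normal form \<open>\<omega>\<^bsup>\<beta>\<^sub>1\<^esup> k\<^sub>1 + \<dots> + \<omega>\<^bsup>\<beta>\<^sub>n\<^esup> k\<^sub>n\<close> with \<open>\<beta>\<^sub>1 > \<dots> > \<beta>\<^sub>n\<close> is represented by its
  finitely supported coefficient function \<open>c\<close>, where \<open>c \<beta>\<^sub>i = k\<^sub>i > 0\<close> and \<open>c \<beta> = 0\<close> elsewhere.\<close>

definition cnf_val :: "(cord \<Rightarrow> nat) \<Rightarrow> cord"
  where "cnf_val c = foldr (\<lambda>b s. omega_pow b * ord_of_nat (c b) + s)
                       (rev (sorted_list_of_set {b. c b \<noteq> 0})) 0"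

definition cnf :: "cord \<Rightarrow> cord \<Rightarrow> nat"
  where "cnf a = (THE c. finite {b. c b \<noteq> 0} \<and> cnf_val c = a)"

definition nat_sum :: "cord \<Rightarrow> cord \<Rightarrow> cord"
  where "nat_sum a b = cnf_val (\<lambda>g. cnf a g + cnf b g)"

definition nat_double :: "cord \<Rightarrow> cord"
  where "nat_double a = nat_sum a a"

section \<open>Cantor--Bendixson derivatives\<close>

definition nonisolated :: "'a topology \<Rightarrow> 'a set"
  where "nonisolated X = {x \<in> topspace X. \<not> openin X {x}}"

definition CB_derivative :: "'a topology \<Rightarrow> cord \<Rightarrow> 'a set"
  where "CB_derivative K b =
           ord_rec (topspace K) (\<lambda>A. nonisolated (subtopology K A)) Inter b"

lemma CB_derivative_simps:
  "CB_derivative K 0 = topspace K"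
  "CB_derivative K (osucc b) = nonisolated (subtopology K (CB_derivative K b))"
  "b \<noteq> 0 \<Longrightarrow> \<not> is_succ b \<Longrightarrow> CB_derivative K b = (\<Inter>x\<in>{..<b}. CB_derivative K x)"
  by (simp_all add: CB_derivative_def ord_rec_limit)

section \<open>Spaces of continuous functions and stable phase retrieval\<close>

text \<open>Elements of \<open>C(X)\<close> are normalised to be \<open>0\<close> outside the carrier of \<open>X\<close>, so that equality of
  functions is equality on the carrier and the vector space operations are pointwise on the
  whole type.\<close>

definition C_space :: "'a topology \<Rightarrow> ('a \<Rightarrow> complex) set"
  where "C_space X = {f. continuous_map X euclidean f \<and> (\<forall>x. x \<notin> topspace X \<longrightarrow> f x = 0)}"

text \<open>The inserted \<open>0\<close> only matters when the carrier is empty.\<close>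

definition sup_norm :: "'a topology \<Rightarrow> ('a \<Rightarrow> complex) \<Rightarrow> real"
  where "sup_norm X f = Sup (insert 0 ((\<lambda>x. cmod (f x)) ` topspace X))"

definition C_subspace :: "'a topology \<Rightarrow> ('a \<Rightarrow> complex) set \<Rightarrow> bool"
  where "C_subspace X E \<longleftrightarrow> E \<subseteq> C_space X \<and> (\<lambda>x. 0) \<in> E \<and>
           (\<forall>f\<in>E. \<forall>g\<in>E. (\<lambda>x. f x + g x) \<in> E) \<and> (\<forall>c. \<forall>f\<in>E. (\<lambda>x. c * f x) \<in> E)"

definition does_SPR :: "real \<Rightarrow> 'a topology \<Rightarrow> ('a \<Rightarrow> complex) set \<Rightarrow> bool"
  where "does_SPR C X E \<longleftrightarrow> C_subspace X E \<and>
           (\<forall>f\<in>E. \<forall>g\<in>E.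
              (INF l\<in>{l. cmod l = 1}. sup_norm X (\<lambda>x. f x - l * g x))
                \<le> C * sup_norm X (\<lambda>x. complex_of_real (cmod (f x) - cmod (g x))))"

definition linear_isometric_embedding ::
    "'a topology \<Rightarrow> 'b topology \<Rightarrow> (('a \<Rightarrow> complex) \<Rightarrow> 'b \<Rightarrow> complex) \<Rightarrow> bool"
  where "linear_isometric_embedding X Y T \<longleftrightarrow>
           (\<forall>f\<in>C_space X. T f \<in> C_space Y \<and> sup_norm Y (T f) = sup_norm X f) \<and>
           (\<forall>f\<in>C_space X. \<forall>g\<in>C_space X. T (\<lambda>x. f x + g x) = (\<lambda>y. T f y + T g y)) \<and>
           (\<forall>c. \<forall>f\<in>C_space X. T (\<lambda>x. c * f x) = (\<lambda>y. c * T f y))"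

text \<open>\<open>[1, \<omega>\<^bsup>a\<^esup>]\<close>. An interval is order-convex, so its order topology is its subspace topology.\<close>

definition ord_interval :: "cord \<Rightarrow> cord topology"
  where "ord_interval a = top_of_set {1..omega_pow a}"

text \<open>Type variables are quantified outside of every formula, so a bare \<open>\<exists>C\<close> in front of a
  quantifier over all \<open>K :: 'a topology\<close> would let \<open>C\<close> vary with \<open>'a\<close>. Requiring that \<open>C\<close> be
  bounded by a fixed number makes the constant uniform over all compact Hausdorff spaces on all
  types. The value is a convenient, non-optimal one.\<close>

definition SPR_bound :: real
  where "SPR_bound = 100"

end

(* The product of two copies of L = [1, omega^alpha] has a single point of maximal Cantor-Bendixson
   rank, and that rank is the natural double of alpha. Transfinite recursion on the rank yields, near
   every point of the corresponding derived set of K, a norm-one operator that extends functions on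
   L x L to K (no topological copy of L x L inside K is needed, only points of K at which the
   extension takes the prescribed values). With two such operators of disjoint supports, let T f be
   the sum of the extensions of (f b + f c) / 2 and of (f b + i f c) / 2. On the diagonal the first
   gives back f, so T is isometric. The moduli of T f determine |f b|, |f b + f c| and |f b + i f c|,
   and by polarisation with b a point where |f| is maximal they determine f stably up to a phase. *)

theory Submission
  imports Defs
begin

section \<open>Ordinal arithmetic and Cantor normal forms\<close>

text \<open>The square of L is needed because the point b where |f| is maximal depends on f, so all
  pairs (b, c) must be visible to T. Two points of the derived set provide disjoint supports for two
  operators, one supplying |f b + f c| and the other |f b + i f c|. The obstacle is that K is
  arbitrary: a point x of a derived set need not be the limit of any sequence of other points, so no
  copy of the square can be expected around it. The recursion asks only for countably many disjoint
  open sets near x that contain points of prescribed smaller ranks; these sets may accumulate away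
  from x. If p is the point of top rank, the operator is the constant h p, cut off around x, plus an
  extension of h - h p on each of these sets. Since h - h p is small on all but finitely many pieces
  of the square, the sum converges uniformly, and this gives continuity at every accumulation point.
  The constant 18 is 9 + 9, from the real and the imaginary part of conj (f b) * (f c - l * g c),
  each bounded by 9 d |f b|.\<close>

lemma less_osucc_iff: "x < osucc y \<longleftrightarrow> x \<le> (y::cord)"
  by (meson not_less osucc_le_iff)

lemma osucc_less_limit: "\<not> is_succ b \<Longrightarrow> x < b \<Longrightarrow> osucc x < b"
  by (metis is_succ_def osucc_le_iff order_le_less)

lemma cord_induct [case_names zero succ limit]:
  assumes "P 0" "\<And>b. P b \<Longrightarrow> P (osucc b)"
    "\<And>b. b \<noteq> 0 \<Longrightarrow> \<not> is_succ b \<Longrightarrow> (\<And>x. x < b \<Longrightarrow> P x) \<Longrightarrow> P b"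
  shows "P (a::cord)"
proof (induction a rule: less_induct)
  case (less a)
  then show ?case
    by (metis assms is_succ_def less_osucc)
qed

lemma zero_less_cord_iff: "0 < (x::cord) \<longleftrightarrow> x \<noteq> 0"
  by (auto simp: less_le)

lemma cord_eqI: "(\<And>y. y < a \<longleftrightarrow> y < b) \<Longrightarrow> a = (b::cord)"
  by (meson less_irrefl linorder_neqE)

text \<open>The normal functions of ordinal theory. Left addition, left multiplication by a nonzero
  ordinal and \<open>omega_pow\<close> are all of this kind, which gives strict monotonicity and a
  division algorithm for the three of them at once.\<close>

definition normal_fun :: "(cord \<Rightarrow> cord) \<Rightarrow> bool"
  where "normal_fun f \<longleftrightarrow> (\<forall>b. f b < f (osucc b)) \<and>
    (\<forall>b. b \<noteq> 0 \<longrightarrow> \<not> is_succ b \<longrightarrow> f b = (SUP x\<in>{..<b}. f x))"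

text \<open>\<open>Sup\<close> on \<open>cord\<close> is conditional; it behaves here because an
  initial segment is countable and countable sets are bounded.\<close>

lemma less_SUP_lessThan_iff:
  assumes "b \<noteq> (0::cord)"
  shows "y < (SUP x\<in>{..<b}. f x) \<longleftrightarrow> (\<exists>x<b. y < (f x :: cord))"
proof -
  have "countable {..<b}"
    by (rule countable_subset[OF _ countable_atMost_cord[of b]]) auto
  moreover have "{..<b} \<noteq> {}"
    using assms zero_less_cord_iff by blast
  ultimately show ?thesis
    by (simp add: less_cSUP_iff bdd_above_countable_cord Bex_def)
qed

lemma normal_fun_less_limit_iff:
  assumes "normal_fun f" "b \<noteq> 0" "\<not> is_succ b"
  shows "y < f b \<longleftrightarrow> (\<exists>x<b. y < f x)"
  using assms less_SUP_lessThan_iff[of b y f] unfolding normal_fun_def by metis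

lemma normal_fun_strict_mono:
  assumes "normal_fun f"
  shows "strict_mono f"
proof (rule strict_monoI)
  fix x y :: cord
  show "x < y \<Longrightarrow> f x < f y"
  proof (induction y rule: cord_induct)
    case zero
    then show ?case by (metis zero_le_cord not_less)
  next
    case (succ b)
    then have "f x \<le> f b"
      by (metis less_osucc_iff order_le_less)
    also have "\<dots> < f (osucc b)"
      using assms by (simp add: normal_fun_def)
    finally show ?case .
  next
    case (limit b)
    have "f x < f (osucc x)"
      using assms by (simp add: normal_fun_def)
    moreover have "osucc x < b"
      by (rule osucc_less_limit[OF limit.hyps(2) limit.prems])
    ultimately show ?case
      using normal_fun_less_limit_iff[OF assms limit.hyps(1,2)] by blast
  qed
qed

lemma strict_mono_le_cord: "strict_mono f \<Longrightarrow> b \<le> f (b::cord)"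
proof (induction b rule: less_induct)
  case (less b)
  then show ?case
    by (metis not_less strict_mono_less order.strict_trans2)
qed

text \<open>Abstract division: the least argument whose value exceeds \<open>y\<close> is not 0,
  since \<open>f 0 \<le> y\<close>, and not a limit, by continuity, so it has a predecessor. This
  yields differences, quotients and leading exponents.\<close>

lemma normal_fun_bracket:
  assumes "normal_fun f" "f 0 \<le> y"
  obtains b where "f b \<le> y" "y < f (osucc b)"
proof -
  have mono: "strict_mono f"
    by (rule normal_fun_strict_mono[OF assms(1)])
  define b where "b = (LEAST b. y < f b)"
  have "y < f (osucc y)"
    using strict_mono_le_cord[OF mono, of "osucc y"] less_osucc order.strict_trans2 by blast
  then have b: "y < f b"
    unfolding b_def by (rule LeastI)
  have least: "f c \<le> y" if "c < b" for c
    using that not_less_Least unfolding b_def by (meson not_less)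
  have "b \<noteq> 0"
    using b assms(2) by (auto simp: not_less[symmetric])
  moreover have "is_succ b"
    using normal_fun_less_limit_iff[OF assms(1)] \<open>b \<noteq> 0\<close> b least by (meson not_less)
  ultimately show ?thesis
    using that b least unfolding is_succ_def by (metis less_osucc)
qed

section \<open>Addition, multiplication and powers of omega as normal functions\<close>

lemma normal_fun_plus: "normal_fun ((+) a)"
  by (simp add: normal_fun_def plus_cord_simps less_osucc)

lemma plus_cord_strict_mono: "b < c \<Longrightarrow> a + b < a + (c::cord)"
  using normal_fun_strict_mono[OF normal_fun_plus] by (simp add: strict_mono_less)

lemma le_plus_cord: "a \<le> a + (b::cord)"
  using plus_cord_strict_mono[of 0 b a] zero_less_cord_iff[of b]
  by (cases "b = 0") (auto simp: plus_cord_simps)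

lemma plus_cord_zero_left: "0 + b = (b::cord)"
proof (induction b rule: cord_induct)
  case (limit b)
  show ?case
  proof (rule cord_eqI)
    fix y
    show "y < 0 + b \<longleftrightarrow> y < b"
      unfolding normal_fun_less_limit_iff[OF normal_fun_plus limit.hyps]
      using limit by (metis less_osucc order.strict_trans osucc_less_limit)
  qed
qed (simp_all add: plus_cord_simps)

lemma le_imp_plus_cord:
  assumes "a \<le> (y::cord)"
  obtains b where "y = a + b"
proof -
  obtain b where "a + b \<le> y" "y < a + osucc b"
    using normal_fun_bracket[OF normal_fun_plus, of a y] assms by (auto simp: plus_cord_simps)
  then show ?thesis
    using that[of b] by (simp add: plus_cord_simps less_osucc_iff)
qed

lemma normal_fun_times: "a \<noteq> 0 \<Longrightarrow> normal_fun ((*) a)"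
  unfolding normal_fun_def
  using plus_cord_strict_mono[of 0 a] zero_less_cord_iff[of a]
  by (auto simp: times_cord_simps plus_cord_simps)

lemma times_cord_strict_mono: "a \<noteq> 0 \<Longrightarrow> b < c \<Longrightarrow> a * b < a * (c::cord)"
  using normal_fun_strict_mono[OF normal_fun_times] by (simp add: strict_mono_less)

lemma times_cord_mono: "a \<noteq> 0 \<Longrightarrow> b \<le> c \<Longrightarrow> a * b \<le> a * (c::cord)"
  using times_cord_strict_mono by (metis order_le_less)

lemma times_cord_one: "a * 1 = (a::cord)"
  by (simp add: one_cord_def times_cord_simps plus_cord_zero_left)

lemma ord_of_nat_simps [simp]:
  "ord_of_nat 0 = 0" "ord_of_nat (Suc n) = osucc (ord_of_nat n)"
  by (simp_all add: ord_of_nat_def)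

lemma ord_of_nat_strict_mono: "m < n \<Longrightarrow> ord_of_nat m < ord_of_nat n"
  by (induction n) (auto simp: less_Suc_eq less_osucc intro: order.strict_trans)

text \<open>As \<open>omega\<close> is a \<open>LEAST\<close>, some limit ordinal must exist:
  without one, induction would turn every element of \<open>cord\<close> into a numeral, against
  uncountability.\<close>

lemma omega_limit: "omega \<noteq> 0" "\<not> is_succ omega"
proof -
  have "\<exists>x. x \<noteq> 0 \<and> \<not> is_succ x"
  proof (rule ccontr)
    assume none: "\<nexists>x. x \<noteq> 0 \<and> \<not> is_succ x"
    have "x \<in> range ord_of_nat" for x
    proof (induction x rule: cord_induct)
      case zero
      show ?case using ord_of_nat_simps(1) by (metis rangeI)
    next
      case (succ b)
      then show ?case using ord_of_nat_simps(2) by (metis imageE rangeI)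
    qed (use none in blast)
    then have "countable (UNIV :: cord set)"
      by (metis UNIV_eq_I countableI_type countable_image)
    then show False using uncountable_cord by simp
  qed
  then have "omega \<noteq> 0 \<and> \<not> is_succ omega"
    unfolding omega_def by (rule LeastI_ex)
  then show "omega \<noteq> 0" "\<not> is_succ omega" by auto
qed

lemma less_omega_iff: "x < omega \<longleftrightarrow> x \<in> range ord_of_nat"
proof
  show "x < omega \<Longrightarrow> x \<in> range ord_of_nat"
  proof (induction x rule: cord_induct)
    case zero
    show ?case using ord_of_nat_simps(1) by (metis rangeI)
  next
    case (succ b)
    then have "b \<in> range ord_of_nat"
      using less_osucc order.strict_trans by blast
    then obtain n where "b = ord_of_nat n" by blast
    then have "osucc b = ord_of_nat (Suc n)" by simp
    then show ?case by blast
  next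
    case (limit b)
    then show ?case using not_less_Least unfolding omega_def by blast
  qed
  have "ord_of_nat n < omega" for n
    by (induction n) (use omega_limit zero_less_cord_iff osucc_less_limit in auto)
  then show "x \<in> range ord_of_nat \<Longrightarrow> x < omega" by auto
qed

lemma omega_pow_neq_zero: "omega_pow b \<noteq> 0"
proof (induction b rule: cord_induct)
  case zero
  show ?case by (simp add: omega_pow_simps one_cord_def)
next
  case (succ b)
  then have "omega_pow b * 0 < omega_pow b * omega"
    using omega_limit zero_less_cord_iff times_cord_strict_mono by blast
  then show ?case by (metis omega_pow_simps(2) zero_le_cord not_less)
next
  case (limit b)
  have "0 < omega_pow b"
    unfolding omega_pow_simps(3)[OF limit.hyps] less_SUP_lessThan_iff[OF limit.hyps(1)]
    using limit zero_less_cord_iff by blast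
  then show ?case by simp
qed

lemma normal_fun_omega_pow: "normal_fun omega_pow"
proof -
  have "1 < omega"
    unfolding less_omega_iff using ord_of_nat_simps by (metis one_cord_def rangeI)
  then have "omega_pow b < omega_pow (osucc b)" for b
    using times_cord_strict_mono[OF omega_pow_neq_zero, of 1 omega b]
    by (simp add: omega_pow_simps times_cord_one)
  then show ?thesis
    by (simp add: normal_fun_def omega_pow_simps)
qed

lemma omega_pow_mono: "a \<le> b \<Longrightarrow> omega_pow a \<le> omega_pow b"
  using normal_fun_strict_mono[OF normal_fun_omega_pow] by (simp add: strict_mono_less_eq)

lemma one_le_cord_iff: "1 \<le> (x::cord) \<longleftrightarrow> x \<noteq> 0"
  by (simp add: one_cord_def osucc_le_iff zero_less_cord_iff)

section \<open>Cantor normal forms and their lexicographic comparison\<close>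

abbreviation fin_supp :: "(cord \<Rightarrow> nat) \<Rightarrow> bool"
  where "fin_supp c \<equiv> finite {b. c b \<noteq> 0}"

lemma fin_supp_upd: "fin_supp c \<Longrightarrow> fin_supp (c(b := n))"
  by (rule finite_subset[of _ "insert b {b. c b \<noteq> 0}"]) auto

text \<open>Splits off the leading term. The coefficient at \<open>a\<close> may be 0, so two forms
  with different supports can be split at one common exponent.\<close>

lemma cnf_val_top:
  assumes "fin_supp c" "\<And>b. c b \<noteq> 0 \<Longrightarrow> b \<le> a"
  shows "cnf_val c = omega_pow a * ord_of_nat (c a) + cnf_val (c(a := 0))"
proof (cases "c a = 0")
  case True
  then have "c(a := 0) = c" by auto
  then show ?thesis
    by (simp add: True times_cord_simps plus_cord_zero_left)
next
  case False
  let ?A = "{b. (c(a := 0)) b \<noteq> 0}"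
  have fin: "finite ?A"
    using fin_supp_upd[OF assms(1)] .
  have lt: "b < a" if "b \<in> ?A" for b
    using that assms(2)[of b] by (cases "b = a") (auto intro: le_neq_trans)
  have "sorted_list_of_set {b. c b \<noteq> 0} = sorted_list_of_set ?A @ [a]"
  proof (rule sorted_distinct_set_unique)
    show "set (sorted_list_of_set {b. c b \<noteq> 0}) = set (sorted_list_of_set ?A @ [a])"
      using fin False assms(1) by auto
    show "sorted (sorted_list_of_set ?A @ [a])"
      using fin lt by (simp add: sorted_append less_imp_le)
  qed (use fin in auto)
  moreover have "foldr (\<lambda>b s. omega_pow b * ord_of_nat (c b) + s) (rev (sorted_list_of_set ?A)) 0
     = cnf_val (c(a := 0))"
    unfolding cnf_val_def using fin by (intro foldr_cong) auto
  ultimately show ?thesis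
    unfolding cnf_val_def[of c] by simp
qed

lemma cnf_val_zero: "cnf_val (\<lambda>_. 0) = 0"
  by (simp add: cnf_val_def)

lemma cnf_val_less_omega_pow:
  assumes "fin_supp c" "\<And>b. c b \<noteq> 0 \<Longrightarrow> b < a"
  shows "cnf_val c < omega_pow a"
  using assms
proof (induction "card {b. c b \<noteq> 0}" arbitrary: c a rule: less_induct)
  case less
  show ?case
  proof (cases "{b. c b \<noteq> 0} = {}")
    case True
    then have "c = (\<lambda>_. 0)" by auto
    then show ?thesis
      using omega_pow_neq_zero[of a] zero_less_cord_iff by (auto simp: cnf_val_zero)
  next
    case False
    define M where "M = Max {b. c b \<noteq> 0}"
    have M: "c M \<noteq> 0"
      using Max_in[OF less.prems(1) False] by (simp add: M_def)
    have le: "b \<le> M" if "c b \<noteq> 0" for b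
      using Max_ge[OF less.prems(1), of b] that by (simp add: M_def)
    let ?d = "c(M := 0)"
    have "cnf_val ?d < omega_pow M"
    proof (rule less.hyps)
      show "card {b. ?d b \<noteq> 0} < card {b. c b \<noteq> 0}"
        by (rule psubset_card_mono[OF less.prems(1)]) (use M in \<open>auto split: if_splits\<close>)
      show "fin_supp ?d" by (rule fin_supp_upd[OF less.prems(1)])
      show "b < M" if "?d b \<noteq> 0" for b
        using that le[of b] by (cases "b = M") (auto intro: le_neq_trans)
    qed
    \<comment> \<open>The tail is below \<open>omega_pow M\<close>, so it is absorbed by one further
      copy of \<open>omega_pow M\<close>; any finite number of copies stays below
      \<open>omega_pow (osucc M)\<close>.\<close>
    then have "cnf_val c < omega_pow M * osucc (ord_of_nat (c M))"
      using cnf_val_top[OF less.prems(1) le] by (simp add: times_cord_simps plus_cord_strict_mono)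
    also have "\<dots> \<le> omega_pow M * omega"
      by (rule times_cord_mono[OF omega_pow_neq_zero])
         (metis less_imp_le less_omega_iff ord_of_nat_simps(2) rangeI)
    also have "\<dots> \<le> omega_pow a"
      using less.prems(2)[OF M] omega_pow_mono[of "osucc M" a]
      by (simp add: omega_pow_simps osucc_le_iff)
    finally show ?thesis .
  qed
qed

lemma omega_pow_le_cnf_val:
  assumes "fin_supp c" "c b \<noteq> 0"
  shows "omega_pow b \<le> cnf_val c"
proof -
  have ne: "{b. c b \<noteq> 0} \<noteq> {}" using assms by auto
  define M where "M = Max {b. c b \<noteq> 0}"
  have M: "c M \<noteq> 0"
    using Max_in[OF assms(1) ne] by (simp add: M_def)
  have le: "b \<le> M" if "c b \<noteq> 0" for b
    using Max_ge[OF assms(1), of b] that by (simp add: M_def)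
  have "omega_pow b \<le> omega_pow M * 1"
    using le[OF assms(2)] by (simp add: times_cord_one omega_pow_mono)
  also have "\<dots> \<le> omega_pow M * ord_of_nat (c M)"
    using M by (intro times_cord_mono[OF omega_pow_neq_zero]) (cases "c M"; simp add: one_le_cord_iff)
  also have "\<dots> \<le> cnf_val c"
    using cnf_val_top[OF assms(1) le] by (simp add: le_plus_cord)
  finally show ?thesis .
qed

definition lex_less :: "(cord \<Rightarrow> nat) \<Rightarrow> (cord \<Rightarrow> nat) \<Rightarrow> bool"
  where "lex_less c d \<longleftrightarrow> (\<exists>s. c s < d s \<and> (\<forall>b>s. c b = d b))"

lemma lex_less_linear:
  assumes "fin_supp c" "fin_supp d" "c \<noteq> d"
  shows "lex_less c d \<or> lex_less d c"
proof -
  let ?D = "{b. c b \<noteq> d b}"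
  have fin: "finite ?D"
    by (rule finite_subset[OF _ finite_UnI[OF assms(1,2)]]) auto
  have ne: "?D \<noteq> {}"
    using assms(3) by auto
  define M where "M = Max ?D"
  have "c M < d M \<or> d M < c M"
    using Max_in[OF fin ne] unfolding M_def[symmetric] by auto
  moreover have "\<forall>b>M. c b = d b"
    using Max_ge[OF fin] unfolding M_def[symmetric] by (auto simp: not_le[symmetric])
  ultimately show ?thesis
    unfolding lex_less_def by auto
qed

text \<open>Let \<open>s\<close> be the highest exponent at which the forms differ. Induction on the
  number of terms above \<open>s\<close> peels off the common leading terms. Once \<open>s\<close>
  leads, the tail of \<open>c\<close> is below \<open>omega_pow s\<close>, and the gap of at least
  one in the coefficient decides.\<close>

lemma cnf_val_strict_mono:
  assumes "fin_supp c" "fin_supp d" "lex_less c d"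
  shows "cnf_val c < cnf_val d"
proof -
  obtain s where s: "c s < d s" "\<forall>b>s. c b = d b"
    using assms(3) by (auto simp: lex_less_def)
  show ?thesis
    using assms(1,2) s
  proof (induction "card {b. s < b \<and> c b \<noteq> 0}" arbitrary: c d rule: less_induct)
    case less
    let ?A = "{b. s < b \<and> c b \<noteq> 0}"
    have fin: "finite ?A"
      by (rule finite_subset[OF _ less.prems(1)]) auto
    show ?case
    proof (cases "?A = {}")
      case True
      have le: "b \<le> s" if "c b \<noteq> 0 \<or> d b \<noteq> 0" for b
        by (rule ccontr) (use True that less.prems(4) in \<open>auto simp: not_le\<close>)
      have "cnf_val (c(s := 0)) < omega_pow s"
      proof (rule cnf_val_less_omega_pow)
        show "b < s" if "(c(s := 0)) b \<noteq> 0" for b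
          using that le[of b] by (cases "b = s") (auto intro: le_neq_trans)
      qed (rule fin_supp_upd[OF less.prems(1)])
      then have "cnf_val c < omega_pow s * osucc (ord_of_nat (c s))"
        using cnf_val_top[OF less.prems(1), of s] le
        by (simp add: times_cord_simps plus_cord_strict_mono)
      also have "\<dots> \<le> omega_pow s * ord_of_nat (d s)"
        by (rule times_cord_mono[OF omega_pow_neq_zero])
           (simp add: osucc_le_iff ord_of_nat_strict_mono less.prems(3))
      also have "\<dots> \<le> cnf_val d"
        using cnf_val_top[OF less.prems(2), of s] le by (simp add: le_plus_cord)
      finally show ?thesis .
    next
      case False
      define M where "M = Max ?A"
      have M: "s < M" "c M \<noteq> 0"
        using Max_in[OF fin False] by (simp_all add: M_def)
      have leA: "b \<le> M" if "b \<in> ?A" for b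
        using Max_ge[OF fin that] by (simp add: M_def)
      have le: "b \<le> M" if "c b \<noteq> 0 \<or> d b \<noteq> 0" for b
        using that M leA[of b] less.prems(4) by (cases "s < b") auto
      have "cnf_val (c(M := 0)) < cnf_val (d(M := 0))"
      proof (rule less.hyps)
        show "card {b. s < b \<and> (c(M := 0)) b \<noteq> 0} < card ?A"
          by (rule psubset_card_mono[OF fin]) (use M in \<open>auto split: if_splits\<close>)
      qed (use less.prems M fin_supp_upd in auto)
      then show ?thesis
        using cnf_val_top[OF less.prems(1), of M] cnf_val_top[OF less.prems(2), of M] le
          less.prems(4) M by (simp add: plus_cord_strict_mono)
    qed
  qed
qed

lemma cnf_val_inject:
  assumes "fin_supp c" "fin_supp d" "cnf_val c = cnf_val d"
  shows "c = d"
proof (rule ccontr)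
  assume "c \<noteq> d"
  then show False
    using lex_less_linear[OF assms(1,2)] cnf_val_strict_mono[OF assms(1,2)]
      cnf_val_strict_mono[OF assms(2,1)] assms(3) by auto
qed

text \<open>Division by a power of omega: bracketing gives the leading exponent \<open>r\<close>,
  then the quotient \<open>m\<close>, and the remainder \<open>e < omega_pow r \<le> a\<close> is
  covered by induction.\<close>

lemma ex_cnf: "\<exists>c. fin_supp c \<and> cnf_val c = a"
proof (induction a rule: less_induct)
  case (less a)
  show ?case
  proof (cases "a = 0")
    case True
    then show ?thesis using cnf_val_zero by (intro exI[of _ "\<lambda>_. 0"]) auto
  next
    case False
    then have "omega_pow 0 \<le> a"
      by (simp add: omega_pow_simps one_le_cord_iff)
    then obtain r where r: "omega_pow r \<le> a" "a < omega_pow (osucc r)"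
      using normal_fun_bracket[OF normal_fun_omega_pow] by blast
    obtain m where m: "omega_pow r * m \<le> a" "a < omega_pow r * osucc m"
      using normal_fun_bracket[OF normal_fun_times[OF omega_pow_neq_zero], of r a]
      by (auto simp: times_cord_simps)
    \<comment> \<open>The choice of \<open>r\<close> keeps \<open>a\<close> below
      \<open>omega_pow r * omega\<close>, so the quotient is finite and can serve as a
      coefficient.\<close>
    have "omega_pow r * m < omega_pow r * omega"
      using m(1) r(2) by (simp add: omega_pow_simps)
    then have "m < omega"
      using times_cord_mono[OF omega_pow_neq_zero, of omega m r] by (meson not_le)
    then obtain n where n: "m = ord_of_nat n"
      by (auto simp: less_omega_iff)
    obtain e where e: "a = omega_pow r * m + e"
      using le_imp_plus_cord[OF m(1)] by blast
    have "e < omega_pow r"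
      using m(2) normal_fun_strict_mono[OF normal_fun_plus]
      by (simp add: e times_cord_simps strict_mono_less)
    then obtain d where d: "fin_supp d" "cnf_val d = e"
      using less.IH[OF order.strict_trans2[OF _ r(1)]] by blast
    have supp: "b < r" if "d b \<noteq> 0" for b
      using omega_pow_le_cnf_val[OF d(1) that] omega_pow_mono[of r b] \<open>e < omega_pow r\<close> d(2)
      by (meson not_less order.strict_trans2 order.trans less_irrefl)
    have "d r = 0" using supp by blast
    then have "d(r := 0) = d" by auto
    moreover have "cnf_val (d(r := n)) = omega_pow r * ord_of_nat n + cnf_val ((d(r := n))(r := 0))"
      using cnf_val_top[OF fin_supp_upd[OF d(1)], of r n r] supp
      by (metis fun_upd_apply less_imp_le order_refl)
    ultimately have "cnf_val (d(r := n)) = a"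
      using d(2) e n by simp
    then show ?thesis
      using fin_supp_upd[OF d(1)] by blast
  qed
qed

lemma cnf: "fin_supp (cnf a)" "cnf_val (cnf a) = a"
proof -
  have "\<exists>!c. fin_supp c \<and> cnf_val c = a"
    using ex_cnf cnf_val_inject by blast
  from theI'[OF this] show "fin_supp (cnf a)" "cnf_val (cnf a) = a"
    unfolding cnf_def by auto
qed

lemma cnf_cnf_val: "fin_supp c \<Longrightarrow> cnf (cnf_val c) = c"
  by (rule cnf_val_inject[OF cnf(1)]) (simp_all only: cnf(2))

lemma lex_less_cnf_imp_less: "lex_less (cnf a) (cnf b) \<Longrightarrow> a < b"
  using cnf_val_strict_mono[OF cnf(1) cnf(1), of a b] by (simp only: cnf(2))

lemma less_imp_lex_less_cnf:
  assumes "a < b"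
  shows "lex_less (cnf a) (cnf b)"
proof -
  have "cnf a \<noteq> cnf b"
    using cnf(2) assms by (metis less_irrefl)
  then show ?thesis
    using lex_less_linear[OF cnf(1) cnf(1)] lex_less_cnf_imp_less assms by (metis less_asym)
qed

section \<open>Natural sum and the rank of an ordinal\<close>

lemma nat_sum_commute: "nat_sum a b = nat_sum b a"
  by (simp add: nat_sum_def add.commute)

text \<open>Adding the same coefficients to two forms preserves the highest exponent at which they
  differ and the direction of the inequality there.\<close>

lemma nat_sum_strict_mono_left:
  assumes "a < b"
  shows "nat_sum a c < nat_sum b c"
proof -
  have "fin_supp (\<lambda>g. cnf x g + cnf y g)" for x y
    by (rule finite_subset[OF _ finite_UnI[OF cnf(1)[of x] cnf(1)[of y]]]) auto
  moreover have "lex_less (\<lambda>g. cnf a g + cnf c g) (\<lambda>g. cnf b g + cnf c g)"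
  proof -
    obtain s where s: "cnf a s < cnf b s" "\<forall>g>s. cnf a g = cnf b g"
      using less_imp_lex_less_cnf[OF assms] unfolding lex_less_def by blast
    show ?thesis
      unfolding lex_less_def by (rule exI[of _ s]) (use s in simp)
  qed
  ultimately show ?thesis
    unfolding nat_sum_def by (intro cnf_val_strict_mono)
qed

lemma nat_sum_strict_mono:
  assumes "a \<le> a'" "b \<le> b'" "a < a' \<or> b < b'"
  shows "nat_sum a b < nat_sum a' b'"
proof -
  have "nat_sum x b < nat_sum x b'" if "b < b'" for x
    using nat_sum_strict_mono_left[OF that, of x] by (simp add: nat_sum_commute)
  then show ?thesis
    using assms nat_sum_strict_mono_left[of a a'] by (metis order_le_less order.strict_trans)
qed

text \<open>The Cantor--Bendixson rank of the point \<open>b \<ge> 1\<close> in an interval of ordinals is the least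
  exponent of its Cantor normal form.\<close>

definition ord_rank :: "cord \<Rightarrow> cord"
  where "ord_rank b = (LEAST r. cnf b r \<noteq> 0)"

lemma ord_rank_le: "cnf b r \<noteq> 0 \<Longrightarrow> ord_rank b \<le> r"
  by (simp add: ord_rank_def Least_le)

lemma cnf_ord_rank:
  assumes "b \<noteq> 0"
  shows "cnf b (ord_rank b) \<noteq> 0"
proof -
  have "cnf b \<noteq> (\<lambda>_. 0)"
    using assms cnf(2)[of b] cnf_val_zero by metis
  then have "\<exists>r. cnf b r \<noteq> 0" by auto
  then show ?thesis
    unfolding ord_rank_def by (rule LeastI_ex)
qed

lemma cnf_omega_pow: "cnf (omega_pow a) = (\<lambda>_. 0)(a := 1)"
proof -
  let ?c = "(\<lambda>_. 0)(a := 1) :: cord \<Rightarrow> nat"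
  have "fin_supp ?c" by simp
  moreover have "cnf_val ?c = omega_pow a * ord_of_nat 1 + cnf_val (?c(a := 0))"
    using cnf_val_top[of ?c a] by (auto split: if_splits)
  moreover have "ord_of_nat 1 = 1"
    by (simp add: one_cord_def)
  moreover have "?c(a := 0) = (\<lambda>_. 0)"
    by auto
  ultimately show ?thesis
    using cnf_cnf_val[of ?c] by (simp add: times_cord_one cnf_val_zero plus_cord_simps)
qed

lemma ord_rank_omega_pow: "ord_rank (omega_pow a) = a"
  using cnf_ord_rank[OF omega_pow_neq_zero] by (metis cnf_omega_pow fun_upd_apply)

text \<open>The form of \<open>omega_pow a\<close> has a single nonzero coefficient, so the exponent
  at which \<open>b\<close> falls below it must be \<open>a\<close>. Hence \<open>b\<close> has no
  terms of exponent \<open>a\<close> or more.\<close>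

lemma ord_rank_less_exponent:
  assumes "b \<noteq> 0" "b < omega_pow a"
  shows "ord_rank b < a"
proof -
  obtain s where s: "cnf b s < ((\<lambda>_. 0)(a := 1) :: cord \<Rightarrow> nat) s"
      "\<forall>g>s. cnf b g = ((\<lambda>_. 0)(a := 1)) g"
    using less_imp_lex_less_cnf[OF assms(2)] unfolding cnf_omega_pow lex_less_def by blast
  have "s = a"
    using s(1) by (auto split: if_splits)
  then have "cnf b g = 0" if "a \<le> g" for g
    using s that by (cases "g = a") auto
  then show ?thesis
    using cnf_ord_rank[OF assms(1)] by (meson not_le)
qed

lemma ord_rank_less_nearby:
  assumes "b \<noteq> 0"
  obtains b' where "b' < b" "\<And>e. b' < e \<Longrightarrow> e < b \<Longrightarrow> ord_rank e < ord_rank b"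
proof -
  \<comment> \<open>The left endpoint is \<open>b\<close> with one copy of its last term
    \<open>omega_pow r\<close> removed. Its form and that of \<open>b\<close> differ by one unit at
    \<open>r\<close> only, which leaves no room between them for a form without exponents below
    \<open>r\<close>.\<close>
  define r c c' where "r = ord_rank b" "c = cnf b" "c' = c(r := c r - 1)"
  have c: "fin_supp c" "c r \<noteq> 0" and least: "\<And>g. c g \<noteq> 0 \<Longrightarrow> r \<le> g"
    using cnf cnf_ord_rank[OF assms] ord_rank_le unfolding r_c_c'_def by auto
  have c': "cnf (cnf_val c') = c'"
    using cnf_cnf_val fin_supp_upd[OF c(1)] r_c_c'_def by simp
  show ?thesis
  proof (rule that)
    have "lex_less c' c"
      unfolding lex_less_def using c(2) by (intro exI[of _ r]) (auto simp: r_c_c'_def)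
    then show "cnf_val c' < b"
      using lex_less_cnf_imp_less[of "cnf_val c'" b] unfolding c' by (simp add: r_c_c'_def)
    fix e
    assume e: "cnf_val c' < e" "e < b"
    let ?d = "cnf e"
    show "ord_rank e < ord_rank b"
    proof (rule ccontr)
      assume "\<not> ?thesis"
      then have r: "g < r \<Longrightarrow> ?d g = 0" for g
        using ord_rank_le[of e g] r_c_c'_def(1) by (meson not_less order.trans not_le order.strict_trans1)
      obtain s where s: "?d s < c s" "\<forall>g>s. ?d g = c g"
        using less_imp_lex_less_cnf[OF e(2)] unfolding lex_less_def r_c_c'_def by blast
      obtain t where t: "c' t < ?d t" "\<forall>g>t. c' g = ?d g"
        using less_imp_lex_less_cnf[OF e(1)] unfolding lex_less_def c' by blast
      have "r \<le> s" using s(1) least[of s] by auto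
      have "r \<le> t" using t(1) r[of t] by (metis not_less less_nat_zero_code)
      \<comment> \<open>\<open>s\<close> and \<open>t\<close> are the highest exponents at which
        \<open>e\<close> differs from \<open>b\<close> and from the left endpoint. Both are at least
        \<open>r\<close>, so any order of the two contradicts that the endpoints differ by one unit
        at \<open>r\<close>.\<close>
      show False
      proof (cases s t rule: linorder_cases)
        case less
        then have "t \<noteq> r"
          using \<open>r \<le> s\<close> by auto
        then show ?thesis
          using t(1) s(2) less by (simp add: r_c_c'_def(3))
      next
        case equal
        then show ?thesis
          using t(1) s(1) by (simp add: r_c_c'_def(3) split: if_splits)
      next
        case greater
        then have "s \<noteq> r"
          using \<open>r \<le> t\<close> by auto
        then show ?thesis
          using t(2)[rule_format, OF greater] s(1) by (simp add: r_c_c'_def(3))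
      qed
    qed
  qed
qed

section \<open>Extension operators near points of derived sets\<close>

lemma nonisolated_subtopology_subset: "nonisolated (subtopology K A) \<subseteq> A"
  by (auto simp: nonisolated_def)

lemma CB_derivative_antimono: "a \<le> b \<Longrightarrow> CB_derivative K b \<subseteq> CB_derivative K a"
proof (induction b rule: less_induct)
  case (less b)
  consider "a = b" | "a < b" "is_succ b" | "a < b" "\<not> is_succ b"
    using less.prems by (auto simp: less_le)
  then show ?case
  proof cases
    case 2
    then obtain c where c: "b = osucc c"
      by (auto simp: is_succ_def)
    then have "a \<le> c"
      using 2 osucc_le_iff by (meson not_less)
    then have "CB_derivative K c \<subseteq> CB_derivative K a"
      using less.IH[of c] c less_osucc by blast
    then show ?thesis
      using nonisolated_subtopology_subset[of K "CB_derivative K c"]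
      by (simp add: c CB_derivative_simps)
  next
    case 3
    then have "b \<noteq> 0"
      using zero_le_cord[of a] by (metis not_less)
    then show ?thesis
      using 3 by (auto simp: CB_derivative_simps)
  qed simp
qed

lemma CB_derivative_accumulates:
  assumes "x \<in> CB_derivative K b" "a < b" "openin K U" "x \<in> U"
  obtains y where "y \<in> CB_derivative K a" "y \<in> U" "y \<noteq> x"
proof -
  let ?A = "CB_derivative K a"
  have "x \<in> CB_derivative K (osucc a)"
    using CB_derivative_antimono[of "osucc a" b K] assms(1,2) by (auto simp: osucc_le_iff)
  then have "x \<in> ?A" "\<not> openin (subtopology K ?A) {x}"
    by (auto simp: CB_derivative_simps nonisolated_def)
  moreover have "openin (subtopology K ?A) (U \<inter> ?A)"
    using assms(3) by (auto simp: openin_subtopology)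
  ultimately have "U \<inter> ?A \<noteq> {x}" by auto
  then show ?thesis
    using that \<open>x \<in> ?A\<close> assms(4) by blast
qed

text \<open>The ranks \<open>t n\<close> may come in any order and with repetitions, since each is
  realised in every neighbourhood of \<open>x\<close>. The Hausdorff property separates each new
  point from \<open>x\<close>, and all later stages take place on the side of \<open>x\<close>. The
  sets \<open>G n\<close> need not shrink to \<open>x\<close>.\<close>

lemma CB_derivative_disjoint_neighbourhoods:
  assumes "Hausdorff_space K" and x: "x \<in> CB_derivative K b" and t: "\<And>n::nat. t n < b"
    and D: "openin K D" "x \<in> D"
  shows "\<exists>G y. disjoint_family G \<and> (\<forall>n. openin K (G n) \<and> G n \<subseteq> D \<and> x \<notin> G n \<and>
    y n \<in> G n \<and> y n \<in> CB_derivative K (t n))"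
proof -
  \<comment> \<open>A stage consists of the set \<open>G\<close>, its point \<open>y\<close>, and an
    open \<open>H\<close> around \<open>x\<close> disjoint from \<open>G\<close> that is reserved
    for the later stages.\<close>
  define P where "P = (\<lambda>n (G, H, y). openin K G \<and> openin K H \<and> x \<in> H \<and> G \<inter> H = {} \<and>
      G \<subseteq> D \<and> y \<in> G \<and> y \<in> CB_derivative K (t n))"
  define Q where "Q = (\<lambda>(G :: 'a set, H :: 'a set, y :: 'a) (G', H', y' :: 'a). G' \<subseteq> H \<and> H' \<subseteq> H)"
  have step: "\<exists>G H y. P n (G, H, y) \<and> G \<subseteq> E \<and> H \<subseteq> E" if E: "openin K E" "x \<in> E" for E n
  proof -
    obtain y where y: "y \<in> CB_derivative K (t n)" "y \<in> D \<inter> E" "y \<noteq> x"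
      using CB_derivative_accumulates[OF x t, of "D \<inter> E"] D E by (metis IntI openin_Int)
    then obtain G H where "openin K G" "openin K H" "y \<in> G" "x \<in> H" "disjnt G H"
    proof -
      have "y \<in> topspace K \<and> x \<in> topspace K \<and> y \<noteq> x"
        using y(2,3) D openin_subset by blast
      then show ?thesis
        using assms(1) that unfolding Hausdorff_space_def by blast
    qed
    then have "P n (G \<inter> (D \<inter> E), H \<inter> (D \<inter> E), y)"
      using y D E unfolding P_def by (auto simp: disjnt_def)
    then show ?thesis by blast
  qed
  have "\<exists>f. \<forall>n. P n (f n) \<and> Q (f n) (f (Suc n))"
  proof (rule dependent_nat_choice)
    show "\<exists>z. P 0 z"
      using step[OF D] by blast
    show "\<exists>z'. P (Suc n) z' \<and> Q z z'" if "P n z" for z n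
    proof -
      obtain G H y where z: "z = (G, H, y)" by (cases z) auto
      then have "openin K H" "x \<in> H"
        using that by (simp_all add: P_def)
      then obtain G' H' y' where "P (Suc n) (G', H', y')" "G' \<subseteq> H" "H' \<subseteq> H"
        using step[of H "Suc n"] by blast
      then show ?thesis
        unfolding z by (intro exI[of _ "(G', H', y')"]) (simp add: Q_def)
    qed
  qed
  then obtain f where f: "\<And>n. P n (f n)" "\<And>n. Q (f n) (f (Suc n))" by blast
  define G H y where "G = (\<lambda>n. fst (f n))" "H = (\<lambda>n. fst (snd (f n)))" "y = (\<lambda>n. snd (snd (f n)))"
  have f_eq: "f n = (G n, H n, y n)" for n
    by (simp add: G_H_y_def)
  have P: "openin K (G n)" "x \<in> H n" "G n \<inter> H n = {}" "G n \<subseteq> D" "y n \<in> G n"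
    "y n \<in> CB_derivative K (t n)" for n
    using f(1)[of n] unfolding f_eq P_def by auto
  have Q: "G (Suc n) \<subseteq> H n" "H (Suc n) \<subseteq> H n" for n
    using f(2)[of n] unfolding f_eq Q_def by auto
  have "G (Suc (m + k)) \<subseteq> H m" for m k
    using Q lift_Suc_antimono_le[of H m "m + k"] by (meson le_add1 subset_trans)
  then have lt: "G m \<inter> G n = {}" if "m < n" for m n
    using P(3)[of m] less_imp_Suc_add[OF that] by blast
  then have "disjoint_family G"
    unfolding disjoint_family_on_def by (metis Int_commute linorder_neqE_nat)
  then show ?thesis
    using P by blast
qed

text \<open>Norm-one extension operators: up to continuity, \<open>S h k\<close> is the integral of \<open>h\<close> against a
  subprobability measure on \<open>V\<close>, which for suitable \<open>k\<close> is the point mass at a given point of \<open>V\<close>.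
  The clause with \<open>w\<close> encodes subprobability and is stable under the recursive construction.\<close>

definition ext_op :: "'a topology \<Rightarrow> 'm::topological_space set \<Rightarrow> 'a set \<Rightarrow>
    (('m \<Rightarrow> complex) \<Rightarrow> 'a \<Rightarrow> complex) \<Rightarrow> bool"
  where "ext_op K V U S \<longleftrightarrow>
    (\<forall>h. continuous_on V h \<longrightarrow> continuous_map K euclidean (S h)) \<and>
    (\<forall>h k. k \<notin> U \<longrightarrow> S h k = 0) \<and>
    (\<forall>h g k. S (\<lambda>v. h v + g v) k = S h k + S g k) \<and>
    (\<forall>c h k. S (\<lambda>v. c * h v) k = c * S h k) \<and>
    (\<forall>h k w R. cmod w \<le> R \<longrightarrow> (\<forall>v\<in>V. cmod (h v + w) \<le> R) \<longrightarrow> cmod (S h k + w) \<le> R) \<and>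
    (\<forall>v\<in>V. \<exists>k\<in>U. \<forall>h. S h k = h v)"

lemma ext_opD:
  assumes "ext_op K V U S"
  shows "continuous_on V h \<Longrightarrow> continuous_map K euclidean (S h)"
    "k \<notin> U \<Longrightarrow> S h k = 0"
    "S (\<lambda>v. h v + g v) k = S h k + S g k"
    "S (\<lambda>v. c * h v) k = c * S h k"
    "cmod w \<le> R \<Longrightarrow> (\<And>v. v \<in> V \<Longrightarrow> cmod (h v + w) \<le> R) \<Longrightarrow> cmod (S h k + w) \<le> R"
    "v \<in> V \<Longrightarrow> \<exists>k\<in>U. \<forall>h. S h k = h v"
  using assms unfolding ext_op_def by blast+

text \<open>The part of \<open>V\<close> where \<open>h\<close> is at least \<open>e\<close> away
  from \<open>c\<close> is compact and avoids \<open>p\<close>, so finitely many \<open>W n\<close>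
  cover it; by disjointness the others miss it. If \<open>p\<close> is outside \<open>V\<close>, the
  \<open>W n\<close> cover \<open>V\<close> itself and \<open>c\<close> is arbitrary.\<close>

lemma compact_disjoint_cover_uniform:
  fixes h :: "'m::t2_space \<Rightarrow> complex"
  assumes "compact V" "\<And>n::nat. open (W n)" "(\<Union>n. W n) = V - {p}" "disjoint_family W"
    and h: "continuous_on V h" and c: "p \<in> V \<Longrightarrow> h p = c" and "0 < e"
  obtains N where "\<And>n v. N \<le> n \<Longrightarrow> v \<in> W n \<Longrightarrow> cmod (h v - c) < e"
proof -
  let ?A = "V \<inter> (\<lambda>v. cmod (h v - c)) -` {e..}"
  have "closedin (top_of_set V) ?A"
    by (intro continuous_closedin_preimage continuous_intros h)
  then have A: "compact ?A"
    using assms(1) closedin_compact by blast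
  have A_sub: "?A \<subseteq> (\<Union>n. W n)"
    unfolding assms(3) using c \<open>0 < e\<close> by auto
  obtain F where F: "finite F" "?A \<subseteq> (\<Union>n\<in>F. W n)"
    by (rule compactE_image[OF A assms(2) A_sub])
  then obtain N where N: "\<And>n. n \<in> F \<Longrightarrow> n < N"
    by (meson finite_nat_bounded lessThan_iff subsetD)
  show ?thesis
  proof (rule that)
    fix n v
    assume n: "N \<le> n" "v \<in> W n"
    have "v \<notin> W m" if "m \<in> F" for m
    proof -
      have "m \<noteq> n" using N[OF that] n(1) by simp
      then show ?thesis
        using assms(4) n(2) by (auto simp: disjoint_family_on_def)
    qed
    then have "v \<notin> ?A"
      using F by blast
    moreover have "v \<in> V"
      using n(2) assms(3) by blast
    ultimately show "cmod (h v - c) < e" by simp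
  qed
qed

text \<open>Convexity of the disc of radius \<open>R\<close>, needed where the cut-off function lies
  between 0 and 1.\<close>

lemma cmod_convex_bound:
  assumes "cmod w \<le> R" "cmod (c + w) \<le> R" "0 \<le> t" "t \<le> 1"
  shows "cmod (of_real t * c + w) \<le> R"
proof -
  have "of_real t * c + w = of_real t * (c + w) + of_real (1 - t) * w"
    by (simp add: algebra_simps)
  then have "cmod (of_real t * c + w) \<le> t * cmod (c + w) + (1 - t) * cmod w"
    by (metis norm_triangle_ineq norm_mult norm_of_real abs_of_nonneg assms(3,4) diff_ge_0_iff_ge)
  also have "\<dots> \<le> t * R + (1 - t) * R"
    using assms by (intro add_mono mult_left_mono) auto
  finally show ?thesis by (simp add: algebra_simps)
qed

text \<open>Gluing at \<open>x\<close>: the value at \<open>p\<close> is spread out by a cut-off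
  function equal to 1 on \<open>C\<close>, and on each \<open>G n\<close> the operator
  \<open>S n\<close> adds the extension of the deviation from that value.\<close>

lemma ext_op_assemble:
  fixes V :: "'m::t2_space set"
  assumes "normal_space K" "compact V"
    and W: "\<And>n::nat. open (W n)" "(\<Union>n. W n) = V - {p}" "disjoint_family W"
    and C: "closedin K C" "openin K U" "C \<subseteq> U" "x \<in> C"
    and G: "\<And>n. G n \<subseteq> C" "disjoint_family G" "\<And>n. x \<notin> G n"
    and S: "\<And>n. ext_op K (W n) (G n) (S n)"
  shows "\<exists>T. ext_op K V U T"
proof -
  have "closedin K (topspace K - U)" "disjnt (topspace K - U) C"
    using C by (auto simp: disjnt_def)
  then obtain u where u: "continuous_map K (top_of_set {0..1}) u"
      "u ` (topspace K - U) \<subseteq> {0::real}" "u ` C \<subseteq> {1}"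
    using Urysohn_lemma[OF assms(1) _ C(1), of "topspace K - U" 0 1] by auto
  \<comment> \<open>\<open>u\<close> is controlled on the carrier only, whereas
    \<open>ext_op\<close> demands the value 0 at every point of the type outside
    \<open>U\<close>.\<close>
  define e where "e = (\<lambda>k. if k \<in> topspace K then u k else 0)"
  have e01: "0 \<le> e k" "e k \<le> 1" for k
    using u(1) by (auto simp: e_def continuous_map_in_subtopology image_subset_iff)
  have e0: "e k = 0" if "k \<notin> U" for k
    using u(2) that by (auto simp: e_def)
  have e1: "e k = 1" if "k \<in> C" for k
    using u(3) that closedin_subset[OF C(1)] by (auto simp: e_def)
  have e_cont: "continuous_map K euclideanreal e"
    using u(1) by (auto simp: continuous_map_in_subtopology e_def intro: continuous_map_eq)
  \<comment> \<open>If \<open>p\<close> is outside \<open>V\<close>, the value \<open>h p\<close> is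
    not controlled by the bounds on \<open>V\<close>; with the default 0 the bound clause for
    \<open>c h\<close> reduces to \<open>cmod w \<le> R\<close>.\<close>
  define c where "c = (\<lambda>h. if p \<in> V then h p else (0::complex))"
  \<comment> \<open>By disjointness \<open>SOME\<close> selects the only index available, so the
    second summand is the sum over all \<open>n\<close> without any question of convergence.\<close>
  define T where "T = (\<lambda>h k. of_real (e k) * c h +
      (if k \<in> (\<Union>n. G n) then S (SOME n. k \<in> G n) (\<lambda>v. h v - c h) k else 0))"
  have T_in: "T h k = c h + S n (\<lambda>v. h v - c h) k" if "k \<in> G n" for h k n
  proof -
    have "k \<in> G (SOME n. k \<in> G n)"
      using that by (rule someI)
    then have "(SOME n. k \<in> G n) = n"
      using G(2) that by (auto simp: disjoint_family_on_def)
    moreover have "e k = 1"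
      using e1 G(1) that by blast
    ultimately show ?thesis
      using that by (auto simp: T_def)
  qed
  have T_out: "T h k = of_real (e k) * c h" if "\<And>n. k \<notin> G n" for h k
    using that by (simp add: T_def)
  have W_sub: "W n \<subseteq> V" for n
    using W(2) by blast
  have "continuous_map K euclidean (T h)" if h: "continuous_on V h" for h
  proof -
    \<comment> \<open>Partial sums are continuous as finite sums. On \<open>G n\<close> they are
      exact once \<open>n < N\<close>; before that the error is the value of \<open>S n\<close> on a
      function that is small on \<open>W n\<close>.\<close>
    define f where "f = (\<lambda>N k. of_real (e k) * c h + (\<Sum>n<N. S n (\<lambda>v. h v - c h) k))"
    have "continuous_map K euclidean (f N)" for N
      unfolding f_def
    proof (intro continuous_map_add continuous_map_sum)
      have "continuous_map euclidean euclidean (\<lambda>t::real. of_real t * c h)"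
        by (auto intro!: continuous_intros)
      from continuous_map_compose[OF e_cont this]
      show "continuous_map K euclidean (\<lambda>k. of_real (e k) * c h)"
        by (simp add: o_def)
      show "continuous_map K euclidean (\<lambda>k. S n (\<lambda>v. h v - c h) k)" for n
        by (intro ext_opD(1)[OF S] continuous_intros continuous_on_subset[OF h W_sub])
    qed auto
    moreover have "\<forall>\<^sub>F N in sequentially. \<forall>k\<in>topspace K. T h k \<in> UNIV \<and> dist (f N k) (T h k) < r"
      if "0 < r" for r
    proof -
      \<comment> \<open>The bound clause gives a non-strict inequality, hence half of
        \<open>r\<close>.\<close>
      have r2: "0 < r / 2" using that by simp
      obtain N0 where N0: "\<And>n v. N0 \<le> n \<Longrightarrow> v \<in> W n \<Longrightarrow> cmod (h v - c h) < r / 2"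
        by (rule compact_disjoint_cover_uniform[OF assms(2) W h _ r2, of "c h"])
           (auto simp: c_def)
      have "dist (f N k) (T h k) < r" if "N0 \<le> N" for N k
      proof (cases "\<exists>n. k \<in> G n")
        case True
        then obtain n where n: "k \<in> G n" by blast
        have zero: "S m (\<lambda>v. h v - c h) k = 0" if "m \<noteq> n" for m
          using G(2) n that by (intro ext_opD(2)[OF S]) (auto simp: disjoint_family_on_def)
        have ek: "e k = 1"
          using e1 G(1) n by blast
        have sum: "(\<Sum>m<N. S m (\<lambda>v. h v - c h) k) = (if n < N then S n (\<lambda>v. h v - c h) k else 0)"
        proof -
          have "(\<Sum>m<N. S m (\<lambda>v. h v - c h) k) =
              (\<Sum>m<N. if m = n then S n (\<lambda>v. h v - c h) k else 0)"
            by (rule sum.cong) (use zero in auto)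
          then show ?thesis by simp
        qed
        show ?thesis
        proof (cases "n < N")
          case True
          then show ?thesis
            using \<open>0 < r\<close> by (simp add: T_in[OF n] f_def sum ek)
        next
          case False
          then have "cmod (h v - c h + 0) \<le> r / 2" if "v \<in> W n" for v
            using N0[of n v] \<open>N0 \<le> N\<close> that by simp
          then have "cmod (S n (\<lambda>v. h v - c h) k + 0) \<le> r / 2"
            using r2 by (intro ext_opD(5)[OF S]) auto
          then show ?thesis
            using False \<open>0 < r\<close> by (simp add: T_in[OF n] f_def sum ek dist_norm)
        qed
      next
        case False
        then have "S n (\<lambda>v. h v - c h) k = 0" for n
          by (intro ext_opD(2)[OF S]) auto
        then show ?thesis
          using T_out[of k h] False \<open>0 < r\<close> by (simp add: f_def)
      qed
      then show ?thesis
        by (auto simp: eventually_sequentially)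
    qed
    ultimately have "continuous_map K Met_TC.mtopology (T h)"
      by (intro Met_TC.continuous_map_uniform_limit[where F = sequentially and f = f]) auto
    then show ?thesis by simp
  qed
  moreover have "T h k = 0" if "k \<notin> U" for h k
    using T_out[of k h] G(1) C(3) that by (auto simp: e0)
  moreover have "T (\<lambda>v. h v + g v) k = T h k + T g k" for h g k
  proof -
    have c: "c (\<lambda>v. h v + g v) = c h + c g"
      by (simp add: c_def)
    have "S n (\<lambda>v. (h v - c h) + (g v - c g)) k = S n (\<lambda>v. h v - c h) k + S n (\<lambda>v. g v - c g) k" for n
      by (rule ext_opD(3)[OF S])
    moreover have "(\<lambda>v. h v + g v - (c h + c g)) = (\<lambda>v. (h v - c h) + (g v - c g))"
      by auto
    ultimately have S': "S n (\<lambda>v. h v + g v - (c h + c g)) k = S n (\<lambda>v. h v - c h) k + S n (\<lambda>v. g v - c g) k" for n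
      by simp
    show ?thesis
      unfolding T_def c S' by (simp add: algebra_simps)
  qed
  moreover have "T (\<lambda>v. a * h v) k = a * T h k" for a h k
  proof -
    have c: "c (\<lambda>v. a * h v) = a * c h"
      by (simp add: c_def)
    have "S n (\<lambda>v. a * (h v - c h)) k = a * S n (\<lambda>v. h v - c h) k" for n
      by (rule ext_opD(4)[OF S])
    then have S': "S n (\<lambda>v. a * h v - a * c h) k = a * S n (\<lambda>v. h v - c h) k" for n
      by (simp add: right_diff_distrib)
    show ?thesis
      unfolding T_def c S' by (simp add: algebra_simps)
  qed
  moreover have "cmod (T h k + w) \<le> R"
    if w: "cmod w \<le> R" and h: "\<forall>v\<in>V. cmod (h v + w) \<le> R" for h k w R
  proof -
    have cw: "cmod (c h + w) \<le> R"
      using w h by (auto simp: c_def)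
    show ?thesis
    proof (cases "\<exists>n. k \<in> G n")
      case True
      then obtain n where n: "k \<in> G n" by blast
      \<comment> \<open>The clause for \<open>S n\<close> is used with the shift
        \<open>c h + w\<close>, which turns the deviation back into \<open>h\<close>. The translate
        \<open>w\<close> in \<open>ext_op\<close> makes this recursion possible without loss in the
        norm.\<close>
      have "cmod (S n (\<lambda>v. h v - c h) k + (c h + w)) \<le> R"
        using W_sub[of n] h by (intro ext_opD(5)[OF S] cw) auto
      then show ?thesis
        by (simp add: T_in[OF n] algebra_simps)
    next
      case False
      then show ?thesis
        using cmod_convex_bound[OF w cw e01] by (simp add: T_out)
    qed
  qed
  moreover have "\<exists>k\<in>U. \<forall>h. T h k = h v" if "v \<in> V" for v
  proof (cases "v = p")
    case True
    \<comment> \<open>Evaluation at \<open>p\<close> is realised at the centre \<open>x\<close>,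
      which lies in \<open>C\<close> and in no \<open>G n\<close>.\<close>
    then have "T h x = h v" for h
      using that G(3) e1[OF C(4)] by (simp add: T_out c_def)
    then show ?thesis
      using C(3,4) by blast
  next
    case False
    then have "v \<in> (\<Union>n. W n)"
      unfolding W(2) using that by simp
    then obtain n where n: "v \<in> W n" by auto
    obtain k where k: "k \<in> G n" "\<And>h. S n h k = h v"
      using ext_opD(6)[OF S n] by auto
    have "T h k = h v" for h
      by (simp add: T_in[OF k(1)] k(2))
    moreover have "k \<in> U"
      using k(1) G(1) C(3) by auto
    ultimately show ?thesis by auto
  qed
  ultimately have "ext_op K V U T"
    unfolding ext_op_def by blast
  then show ?thesis by blast
qed

text \<open>\<open>r\<close> is an abstract rank on \<open>M\<close>: each point has arbitrarily
  small compact open neighbourhoods in which it alone has top rank. Induction on \<open>b\<close>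
  cuts \<open>V - {p}\<close> into countably many compact open pieces with ranks bounded below
  \<open>b\<close>, treats each near a point of the corresponding derived set, and glues at
  \<open>x\<close>.\<close>

lemma ext_op_exists:
  fixes r :: "'m::t2_space \<Rightarrow> cord"
  assumes K: "compact_space K" "Hausdorff_space K" and "countable M"
    and base: "\<And>q D. q \<in> M \<Longrightarrow> open D \<Longrightarrow> q \<in> D \<Longrightarrow>
      \<exists>V. compact V \<and> open V \<and> q \<in> V \<and> V \<subseteq> D \<and> (\<forall>v\<in>V - {q}. r v < r q)"
  assumes "compact V" "open V" "V \<subseteq> M" "\<forall>v\<in>V - {p}. r v < b"
    "x \<in> CB_derivative K b" "openin K U" "x \<in> U"
  shows "\<exists>S. ext_op K V U S"
  using assms(5-)
proof (induction b arbitrary: V p x U rule: less_induct)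
  case (less b V p x U)
  have normal: "normal_space K"
    using K compact_Hausdorff_or_regular_imp_normal_space by blast
  have "neighbourhood_base_of (closedin K) K"
    using K compact_Hausdorff_imp_regular_space neighbourhood_base_of_closedin by blast
  \<comment> \<open>\<open>D\<close> is open and receives the sets \<open>G n\<close>; between the
    closed set \<open>C\<close> and the complement of \<open>U\<close> there is room for a Urysohn
    function.\<close>
  then obtain D C where DC: "openin K D" "closedin K C" "x \<in> D" "D \<subseteq> C" "C \<subseteq> U"
    using less.prems(6,7) unfolding neighbourhood_base_of by meson
  show ?case
  proof (cases "V - {p} = {}")
    case True
    \<comment> \<open>The enumeration below needs a nonempty set, so the case of at most one point
      is glued from empty pieces.\<close>
    have "ext_op K {} {} (\<lambda>(h :: 'm \<Rightarrow> complex) k. 0)"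
      by (simp add: ext_op_def)
    then show ?thesis
      using True DC by (intro ext_op_assemble[OF normal less.prems(1), where p = p and x = x and C = C
            and W = "\<lambda>_. {}" and G = "\<lambda>_. {}" and S = "\<lambda>_ _ _. 0"] less.prems)
        (auto simp: disjoint_family_on_def)
  next
    case False
    have cV: "countable (V - {p})"
      using \<open>countable M\<close> less.prems(3) by (meson countable_Diff countable_subset)
    define q where "q = from_nat_into (V - {p})"
    have q: "range q = V - {p}"
      unfolding q_def by (rule range_from_nat_into[OF False cV])
    have rq: "r (q n) < b" for n
      using q less.prems(4) by blast
    have "\<exists>N. compact N \<and> open N \<and> q n \<in> N \<and> N \<subseteq> V - {p} \<and> (\<forall>v\<in>N - {q n}. r v < r (q n))" for n
      using base[of "q n" "V - {p}"] q less.prems(2,3) by (metis open_delete rangeI subsetD Diff_iff)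
    then obtain N where N: "\<And>n. compact (N n)" "\<And>n. open (N n)" "\<And>n. q n \<in> N n"
        "\<And>n. N n \<subseteq> V - {p}" "\<And>n v. v \<in> N n - {q n} \<Longrightarrow> r v < r (q n)"
      by metis
    define W where "W = disjointed N"
    have W_sub: "W n \<subseteq> N n" for n
      unfolding W_def by (rule disjointed_subset)
    have W_eq: "W n = N n - (\<Union>i\<in>{0..<n}. N i)" for n
      by (simp add: W_def disjointed_def)
    \<comment> \<open>Compact sets are closed here, so all \<open>N n\<close> are clopen and making
      them disjoint preserves both properties.\<close>
    have W: "compact (W n)" "open (W n)" for n
      unfolding W_eq by (intro compact_diff open_Diff closed_UN open_UN ballI N compact_imp_closed
          finite_atLeastLessThan)+
    have W_Un: "(\<Union>n. W n) = V - {p}"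
    proof -
      have "V - {p} \<subseteq> (\<Union>n. N n)"
        unfolding q[symmetric] using N(3) by auto
      moreover have "(\<Union>n. N n) \<subseteq> V - {p}"
        using N(4) by (rule UN_least)
      ultimately show ?thesis
        unfolding W_def UN_disjointed_eq by (intro equalityI)
    qed
    obtain G y where Gy: "disjoint_family G" "\<forall>n. openin K (G n) \<and> G n \<subseteq> D \<and> x \<notin> G n \<and>
        y n \<in> G n \<and> y n \<in> CB_derivative K (r (q n))"
      using CB_derivative_disjoint_neighbourhoods[OF K(2) less.prems(5), of "\<lambda>n. r (q n)" D,
          OF rq DC(1,3)] by (elim exE conjE)
    then have G: "\<And>n. openin K (G n)" "\<And>n. G n \<subseteq> D" "\<And>n. x \<notin> G n"
        and y: "\<And>n. y n \<in> G n" "\<And>n. y n \<in> CB_derivative K (r (q n))"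
      by simp_all
    \<comment> \<open>\<open>W n\<close> may have lost \<open>q n\<close> to an earlier
      \<open>N i\<close>; the induction therefore allows a top point outside its set.\<close>
    have "\<exists>S. ext_op K (W n) (G n) S" for n
    proof (rule less.IH[OF rq W _ _ y(2) G(1) y(1)])
      show "W n \<subseteq> M"
        using W_Un less.prems(3) by blast
      show "\<forall>v\<in>W n - {q n}. r v < r (q n)"
        using W_sub N(5) by blast
    qed
    then obtain S where S: "\<And>n. ext_op K (W n) (G n) (S n)" by metis
    show ?thesis
    proof (rule ext_op_assemble[OF normal less.prems(1) W(2) W_Un _ DC(2) less.prems(6) DC(5)
          _ _ Gy(1) G(3) S])
      show "disjoint_family W"
        unfolding W_def by (rule disjoint_family_disjointed)
    qed (use DC G(2) in auto)
  qed
qed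

section \<open>Products of ordinal intervals\<close>

text \<open>A member of the cover that contains \<open>b\<close> swallows some
  \<open>{a<..b}\<close>, and \<open>{..a}\<close> is covered by induction.\<close>

lemma compact_atMost_cord: "compact {..b::cord}"
proof (induction b rule: less_induct)
  case (less b)
  show ?case
  proof (rule compactI)
    fix \<C> :: "cord set set"
    assume C: "\<forall>B\<in>\<C>. open B" "{..b} \<subseteq> \<Union>\<C>"
    then obtain B where B: "B \<in> \<C>" "b \<in> B" by blast
    show "\<exists>\<D>\<subseteq>\<C>. finite \<D> \<and> {..b} \<subseteq> \<Union>\<D>"
    proof (cases "b = 0")
      case True
      have "{..b} \<subseteq> {b}"
        unfolding True by (auto intro: order.antisym)
      then show ?thesis
        using B by (intro exI[of _ "{B}"]) auto
    next
      case False
      then have "open B" "0 < b"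
        using C(1) B(1) zero_less_cord_iff by auto
      then obtain a where a: "a < b" "{a<..b} \<subseteq> B"
        using open_left[of B b 0] B(2) by blast
      have "{..a} \<subseteq> \<Union>\<C>"
        using C(2) a(1) by (meson atMost_subset_iff less_imp_le subset_trans)
      then obtain \<D> where D: "\<D> \<subseteq> \<C>" "finite \<D>" "{..a} \<subseteq> \<Union>\<D>"
        using compactE[OF less.IH[OF a(1)], of \<C>] C(1) by auto
      have "{..b} \<subseteq> {..a} \<union> {a<..b}" by auto
      then have "{..b} \<subseteq> \<Union>(insert B \<D>)"
        using D(3) a(2) by auto
      then show ?thesis
        using D(1,2) B(1) by (intro exI[of _ "insert B \<D>"]) auto
    qed
  qed
qed

lemma compact_greaterThanAtMost_cord: "compact {a<..b::cord}"
proof -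
  have "{a<..b} = {..b} \<inter> {osucc a..}"
    by (auto simp: osucc_le_iff)
  then show ?thesis
    by (simp add: compact_Int_closed compact_atMost_cord)
qed

lemma open_greaterThanAtMost_cord: "open {a<..b::cord}"
proof -
  have "{a<..b} = {a<..<osucc b}"
    by (auto simp: less_osucc_iff)
  then show ?thesis by simp
qed

lemma one_atLeastAtMost_cord: "{1..b::cord} = {0<..b}"
  by (auto simp: one_cord_def osucc_le_iff)

lemma cord_rank_neighbourhood:
  assumes "b \<noteq> 0" "open A" "b \<in> A"
  obtains a where "{a<..b} \<subseteq> A" "a < b" "\<And>e. a < e \<Longrightarrow> e < b \<Longrightarrow> ord_rank e < ord_rank b"
proof -
  obtain a1 where a1: "a1 < b" "{a1<..b} \<subseteq> A"
    using open_left[OF assms(2,3), of 0] assms(1) zero_less_cord_iff by blast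
  obtain a2 where a2: "a2 < b" "\<And>e. a2 < e \<Longrightarrow> e < b \<Longrightarrow> ord_rank e < ord_rank b"
    using ord_rank_less_nearby[OF assms(1)] by blast
  show ?thesis
  proof (rule that[of "max a1 a2"])
    have "{max a1 a2<..b} \<subseteq> {a1<..b}" by auto
    then show "{max a1 a2<..b} \<subseteq> A" using a1(2) by blast
  qed (use a1 a2 in auto)
qed

text \<open>The rank of a pair is the natural sum of the ranks. It must drop as soon as either
  coordinate drops; ordinary addition, not strictly monotone on the left, would not do. Only the
  corner has the full rank \<open>nat_double \<alpha>\<close>.\<close>

lemma ext_op_square:
  fixes K :: "'a topology" and \<alpha> :: cord
  defines "L \<equiv> {1..omega_pow \<alpha>}"
  assumes K: "compact_space K" "Hausdorff_space K"
    and x: "x \<in> CB_derivative K (nat_double \<alpha>)" "openin K U" "x \<in> U"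
  shows "\<exists>S. ext_op K (L \<times> L) U S"
proof -
  define r where "r = (\<lambda>v. nat_sum (ord_rank (fst v)) (ord_rank (snd v)))"
  have L: "L = {0<..omega_pow \<alpha>}"
    by (simp add: L_def one_atLeastAtMost_cord)
  have "countable L"
    by (rule countable_subset[OF _ countable_atMost_cord[of "omega_pow \<alpha>"]]) (auto simp: L)
  then have "countable (L \<times> L)" by simp
  moreover have "\<exists>V. compact V \<and> open V \<and> q \<in> V \<and> V \<subseteq> D \<and> (\<forall>v\<in>V - {q}. r v < r q)"
    if q: "q \<in> L \<times> L" and D: "open D" "q \<in> D" for q D
  proof -
    obtain b c where bc: "q = (b, c)" "b \<noteq> 0" "c \<noteq> 0"
      using q by (cases q) (auto simp: L)
    obtain A B where AB: "open A" "open B" "b \<in> A" "c \<in> B" "A \<times> B \<subseteq> D"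
      using open_prod_elim[OF D] unfolding bc(1) by (metis mem_Sigma_iff)
    obtain a where a: "{a<..b} \<subseteq> A" "a < b" "\<And>e. a < e \<Longrightarrow> e < b \<Longrightarrow> ord_rank e < ord_rank b"
      using cord_rank_neighbourhood[OF bc(2) AB(1,3)] by metis
    obtain a' where a': "{a'<..c} \<subseteq> B" "a' < c" "\<And>e. a' < e \<Longrightarrow> e < c \<Longrightarrow> ord_rank e < ord_rank c"
      using cord_rank_neighbourhood[OF bc(3) AB(2,4)] by metis
    let ?V = "{a<..b} \<times> {a'<..c}"
    have "r v < r q" if v: "v \<in> ?V - {q}" for v
    proof -
      obtain d e where de: "v = (d, e)" by (cases v)
      have "a < d" "d \<le> b" "a' < e" "e \<le> c" "d \<noteq> b \<or> e \<noteq> c"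
        using v bc(1) de by auto
      then have "ord_rank d \<le> ord_rank b" "ord_rank e \<le> ord_rank c"
          "ord_rank d < ord_rank b \<or> ord_rank e < ord_rank c"
        using a(3)[of d] a'(3)[of e] by (metis order_le_less)+
      then show ?thesis
        unfolding r_def bc(1) de by (simp add: nat_sum_strict_mono)
    qed
    moreover have "?V \<subseteq> D"
      using a(1) a'(1) AB(5) by blast
    moreover have "compact ?V" "open ?V"
      by (intro compact_Times compact_greaterThanAtMost_cord open_Times open_greaterThanAtMost_cord)+
    ultimately show ?thesis
      using a(2) a'(2) bc(1) by (intro exI[of _ ?V]) auto
  qed
  moreover have "compact (L \<times> L)" "open (L \<times> L)"
    unfolding L
    by (intro compact_Times compact_greaterThanAtMost_cord open_Times open_greaterThanAtMost_cord)+
  moreover have "\<forall>v\<in>L \<times> L - {(omega_pow \<alpha>, omega_pow \<alpha>)}. r v < nat_double \<alpha>"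
  proof
    fix v
    assume v: "v \<in> L \<times> L - {(omega_pow \<alpha>, omega_pow \<alpha>)}"
    obtain d e where de: "v = (d, e)" by (cases v)
    have le: "ord_rank b < \<alpha> \<or> b = omega_pow \<alpha> \<and> ord_rank b = \<alpha>" if "b \<in> L" for b
    proof -
      have "b \<noteq> 0" "b \<le> omega_pow \<alpha>"
        using that by (auto simp: L)
      then show ?thesis
        using ord_rank_less_exponent[of b \<alpha>] ord_rank_omega_pow[of \<alpha>] by (metis order_le_less)
    qed
    have "d \<in> L" "e \<in> L" "d \<noteq> omega_pow \<alpha> \<or> e \<noteq> omega_pow \<alpha>"
      using v de by auto
    then have "ord_rank d \<le> \<alpha>" "ord_rank e \<le> \<alpha>" "ord_rank d < \<alpha> \<or> ord_rank e < \<alpha>"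
      using le[of d] le[of e] by (metis order_le_less)+
    then show "r v < nat_double \<alpha>"
      unfolding r_def de nat_double_def by (simp add: nat_sum_strict_mono)
  qed
  ultimately show ?thesis
    using ext_op_exists[OF K, of "L \<times> L" r "L \<times> L"] x by blast
qed

section \<open>Stable recovery up to a phase\<close>

text \<open>Polarisation: expand \<open>(cmod (A + u * z))\<^sup>2\<close> for \<open>z = x\<close>
  and \<open>z = y\<close> and subtract. With \<open>R = cmod A\<close>, the first moduli differ by
  at most \<open>2 * d + d\<close> and add up to at most \<open>2 * R + 3 * R\<close>, giving 15;
  the moduli of \<open>x\<close> and \<open>y\<close> give 3; half of 18 is 9.\<close>

lemma Re_inner_bound:
  fixes A B x y u :: complex
  assumes u: "cmod u = 1" and x: "cmod x \<le> cmod A" and d: "d \<le> cmod A"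
    and AB: "cmod (A - B) \<le> d" and xy: "\<bar>cmod x - cmod y\<bar> \<le> d"
    and h: "\<bar>cmod (A + u * x) - cmod (B + u * y)\<bar> \<le> 2 * d"
  shows "\<bar>Re (cnj A * (u * (x - y)))\<bar> \<le> 9 * d * cmod A"
proof -
  define R where "R = cmod A"
  have d0: "0 \<le> d" using AB norm_ge_zero order_trans by blast
  have norm_u: "cmod (u * z) = cmod z" for z
    by (simp add: u norm_mult)
  have "\<bar>cmod (A + u * y) - cmod (B + u * y)\<bar> \<le> cmod (A - B)"
    by (metis add_diff_cancel_right norm_triangle_ineq3)
  then have diff: "\<bar>cmod (A + u * x) - cmod (A + u * y)\<bar> \<le> 3 * d"
    using AB h by linarith
  have "cmod (A + u * x) \<le> 2 * R" "cmod (A + u * y) \<le> 3 * R"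
    using norm_triangle_ineq[of A "u * x"] norm_triangle_ineq[of A "u * y"] x d xy
    unfolding norm_u R_def by linarith+
  then have "\<bar>cmod (A + u * x) - cmod (A + u * y)\<bar> * (cmod (A + u * x) + cmod (A + u * y)) \<le> (3 * d) * (5 * R)"
    using diff by (intro mult_mono) (auto simp: d0)
  then have sq1: "\<bar>(cmod (A + u * x))\<^sup>2 - (cmod (A + u * y))\<^sup>2\<bar> \<le> 15 * (d * R)"
    by (simp add: power2_eq_square square_diff_square_factored abs_mult ac_simps)
  have "\<bar>cmod x - cmod y\<bar> * (cmod x + cmod y) \<le> d * (3 * R)"
    using xy x d by (intro mult_mono) (auto simp: d0 R_def)
  then have sq2: "\<bar>(cmod x)\<^sup>2 - (cmod y)\<^sup>2\<bar> \<le> 3 * (d * R)"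
    by (simp add: power2_eq_square square_diff_square_factored abs_mult ac_simps)
  have expand: "(cmod (A + u * z))\<^sup>2 = R\<^sup>2 + (cmod z)\<^sup>2 + 2 * Re (cnj A * (u * z))" for z
  proof -
    have "(cmod (A + w))\<^sup>2 = R\<^sup>2 + (cmod w)\<^sup>2 + 2 * Re (cnj A * w)" for w
      unfolding R_def cmod_power2 by (simp add: power2_eq_square algebra_simps)
    from this[of "u * z"] show ?thesis
      by (simp add: norm_u)
  qed
  have "Re (cnj A * (u * (x - y))) = Re (cnj A * (u * x)) - Re (cnj A * (u * y))"
    by (simp add: algebra_simps)
  then have "2 * Re (cnj A * (u * (x - y))) =
      ((cmod (A + u * x))\<^sup>2 - (cmod (A + u * y))\<^sup>2) - ((cmod x)\<^sup>2 - (cmod y)\<^sup>2)"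
    unfolding expand by simp
  then have "2 * \<bar>Re (cnj A * (u * (x - y)))\<bar> \<le> 18 * (d * R)"
    using sq1 sq2 by linarith
  then show ?thesis
    by (simp add: R_def)
qed

text \<open>The choices \<open>u = 1\<close> and \<open>u = \<i>\<close> control the real and the
  imaginary part of \<open>cnj A * (x - y)\<close>. As both bounds are proportional to
  \<open>cmod A\<close>, division by it leaves a multiple of \<open>d\<close>.\<close>

lemma phase_recovery_pointwise:
  fixes A B x y :: complex
  assumes x: "cmod x \<le> cmod A" and d: "d \<le> cmod A"
    and AB: "cmod (A - B) \<le> d" and xy: "\<bar>cmod x - cmod y\<bar> \<le> d"
    and h: "\<bar>cmod (A + x) - cmod (B + y)\<bar> \<le> 2 * d"
      "\<bar>cmod (A + \<i> * x) - cmod (B + \<i> * y)\<bar> \<le> 2 * d"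
  shows "cmod (x - y) \<le> 18 * d"
proof (cases "A = 0")
  case True
  then have "cmod A = 0" by simp
  then show ?thesis
    using x d xy norm_ge_zero[of x] norm_ge_zero[of y] norm_triangle_ineq4[of x y] by linarith
next
  case False
  have "\<bar>Re (cnj A * (x - y))\<bar> \<le> 9 * d * cmod A"
    using Re_inner_bound[of 1 x A d B y] x d AB xy h(1) by simp
  moreover have "\<bar>Re (cnj A * (\<i> * (x - y)))\<bar> \<le> 9 * d * cmod A"
    using Re_inner_bound[of \<i> x A d B y] x d AB xy h(2) by simp
  moreover have "Re (cnj A * (\<i> * (x - y))) = - Im (cnj A * (x - y))"
    by (simp add: algebra_simps)
  ultimately have "cmod (cnj A * (x - y)) \<le> (18 * d) * cmod A"
    using cmod_le[of "cnj A * (x - y)"] by simp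
  then show ?thesis
    using False by (simp add: norm_mult mult.commute)
qed

lemma phase_recovery:
  fixes f g :: "'l \<Rightarrow> complex"
  assumes a: "a \<in> L" "\<And>x. x \<in> L \<Longrightarrow> cmod (f x) \<le> cmod (f a)"
    and h0: "\<And>x. x \<in> L \<Longrightarrow> \<bar>cmod (f x) - cmod (g x)\<bar> \<le> d"
    and h1: "\<And>x. x \<in> L \<Longrightarrow> \<bar>cmod (f a + f x) - cmod (g a + g x)\<bar> \<le> 2 * d"
    and h2: "\<And>x. x \<in> L \<Longrightarrow> \<bar>cmod (f a + \<i> * f x) - cmod (g a + \<i> * g x)\<bar> \<le> 2 * d"
  shows "\<exists>l. cmod l = 1 \<and> (\<forall>x\<in>L. cmod (f x - l * g x) \<le> 18 * d)"
proof (cases "d < cmod (f a)")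
  case True
  \<comment> \<open>The phase of \<open>f a\<close> over that of \<open>g a\<close>: it rotates
    \<open>g a\<close> onto the ray of \<open>f a\<close>, so their distance becomes the difference
    of the moduli. \<open>d < cmod (f a)\<close> forces \<open>g a\<close> to be nonzero.\<close>
  define l where "l = (f a / of_real (cmod (f a))) * (of_real (cmod (g a)) / g a)"
  have fa: "cmod (f a) > 0" and ga: "cmod (g a) > 0"
    using True h0[OF a(1)] by linarith+
  have l: "cmod l = 1"
    using fa ga by (simp add: l_def norm_mult norm_divide)
  have "f a - l * g a = (f a / of_real (cmod (f a))) * of_real (cmod (f a) - cmod (g a))"
    using fa ga by (simp add: l_def field_simps)
  then have "cmod (f a - l * g a) = \<bar>cmod (f a) - cmod (g a)\<bar>"
    using fa by (simp add: norm_mult norm_divide flip: of_real_diff)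
  then have "cmod (f a - l * g a) \<le> d"
    using h0[OF a(1)] by simp
  moreover have "cmod (l * g a + l * g x) = cmod (g a + g x)"
      "cmod (l * g a + \<i> * (l * g x)) = cmod (g a + \<i> * g x)" for x
  proof -
    have "l * g a + l * g x = l * (g a + g x)" "l * g a + \<i> * (l * g x) = l * (g a + \<i> * g x)"
      by (simp_all add: algebra_simps)
    then show "cmod (l * g a + l * g x) = cmod (g a + g x)"
      "cmod (l * g a + \<i> * (l * g x)) = cmod (g a + \<i> * g x)"
      using l by (metis norm_mult mult_1)+
  qed
  ultimately have "cmod (f x - l * g x) \<le> 18 * d" if "x \<in> L" for x
    using True a(2)[OF that] h0[OF that] h1[OF that] h2[OF that] l
    by (intro phase_recovery_pointwise[where A = "f a" and B = "l * g a"])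
       (auto simp: norm_mult)
  then show ?thesis using l by blast
next
  case False
  \<comment> \<open>Here \<open>f\<close> is bounded by \<open>d\<close> and \<open>g\<close> by
    \<open>2 * d\<close>, so any phase works.\<close>
  have "cmod (f x - 1 * g x) \<le> 18 * d" if "x \<in> L" for x
    using False a(2)[OF that] h0[OF that] norm_triangle_ineq4[of "f x" "g x"]
    by simp
  then show ?thesis by (intro exI[of _ 1]) simp
qed


section \<open>The embedding\<close>

lemma C_space_bdd_above:
  assumes "compact_space X" "f \<in> C_space X"
  shows "bdd_above (insert 0 ((\<lambda>x. cmod (f x)) ` topspace X))"
proof -
  have "compactin euclidean (f ` topspace X)"
    using assms by (intro image_compactin[of X]) (auto simp: C_space_def compact_space_def)
  then have "bounded (f ` topspace X)"
    by (simp add: compact_imp_bounded)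
  then obtain B where "\<forall>x\<in>topspace X. cmod (f x) \<le> B"
    by (auto simp: bounded_iff)
  then show ?thesis
    by (intro bdd_aboveI[of _ "max 0 B"]) (auto intro: max.coboundedI2)
qed

text \<open>Valid at every point of the type, because \<open>f\<close> vanishes off the carrier;
  evaluation points need not be checked to lie in it.\<close>

lemma cmod_le_sup_norm:
  assumes "compact_space X" "f \<in> C_space X"
  shows "cmod (f x) \<le> sup_norm X f"
proof -
  have "cmod (f x) \<in> insert 0 ((\<lambda>x. cmod (f x)) ` topspace X)"
    using assms(2) by (auto simp: C_space_def)
  then show ?thesis
    unfolding sup_norm_def by (rule cSup_upper[OF _ C_space_bdd_above[OF assms]])
qed

lemma sup_norm_le: "0 \<le> B \<Longrightarrow> (\<And>x. x \<in> topspace X \<Longrightarrow> cmod (f x) \<le> B) \<Longrightarrow> sup_norm X f \<le> B"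
  unfolding sup_norm_def by (rule cSup_least) auto

lemma sup_norm_nonneg: "compact_space X \<Longrightarrow> f \<in> C_space X \<Longrightarrow> 0 \<le> sup_norm X f"
  by (rule order_trans[OF norm_ge_zero cmod_le_sup_norm])

lemma C_space_add: "f \<in> C_space X \<Longrightarrow> g \<in> C_space X \<Longrightarrow> (\<lambda>x. f x + g x) \<in> C_space X"
  by (simp add: C_space_def continuous_map_add)

lemma C_space_compose:
  assumes "f \<in> C_space X" "continuous_on UNIV \<phi>" "\<phi> 0 = 0"
  shows "(\<lambda>x. \<phi> (f x)) \<in> C_space X"
proof -
  have "continuous_map X euclidean (\<phi> \<circ> f)"
    using assms by (intro continuous_map_compose[of X euclidean]) (auto simp: C_space_def)
  then show ?thesis
    using assms by (simp add: C_space_def o_def)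
qed

lemma C_space_scale: "f \<in> C_space X \<Longrightarrow> (\<lambda>x. c * f x) \<in> C_space X"
  by (rule C_space_compose) (auto intro!: continuous_intros)

lemma C_space_cmod: "f \<in> C_space X \<Longrightarrow> (\<lambda>x. complex_of_real (cmod (f x))) \<in> C_space X"
  by (rule C_space_compose) (auto intro!: continuous_intros)

lemma spr_embedding:
  fixes K :: "'a topology" and L :: "'l::topological_space set"
  assumes K: "compact_space K" and L: "compact L" "L \<noteq> {}"
    and S1: "ext_op K (L \<times> L) U1 S1" and S2: "ext_op K (L \<times> L) U2 S2"
    and U: "U1 \<inter> U2 = {}" "U1 \<subseteq> topspace K" "U2 \<subseteq> topspace K"
  shows "\<exists>T. linear_isometric_embedding (top_of_set L) K T \<and>
             does_SPR 18 K (T ` C_space (top_of_set L))"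
proof -
  let ?X = "top_of_set L"
  have X: "compact_space ?X"
    using L(1) by (simp add: compact_space_subtopology)
  \<comment> \<open>Dividing by 2 makes \<open>T\<close> a contraction; the price is the bound
    \<open>2 * d\<close>, instead of \<open>d\<close>, for the recovered moduli.\<close>
  define h1 h2 :: "('l \<Rightarrow> complex) \<Rightarrow> 'l \<times> 'l \<Rightarrow> complex" where
    "h1 = (\<lambda>f v. (f (fst v) + f (snd v)) / 2)" "h2 = (\<lambda>f v. (f (fst v) + \<i> * f (snd v)) / 2)"
  define T where "T = (\<lambda>f k. S1 (h1 f) k + S2 (h2 f) k)"
  \<comment> \<open>By disjointness of supports at most one summand is active at each point, so
    norms combine as a maximum and each modulus concerns a single combination.\<close>
  have T_U1: "T f k = S1 (h1 f) k" if "k \<in> U1" for f k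
    using that U(1) ext_opD(2)[OF S2, of k] by (auto simp: T_def)
  have T_notU1: "T f k = S2 (h2 f) k" if "k \<notin> U1" for f k
    using that ext_opD(2)[OF S1, of k] by (simp add: T_def)
  have T_C: "T f \<in> C_space K" if f: "f \<in> C_space ?X" for f
  proof -
    have cont: "continuous_on L f"
      using f by (simp add: C_space_def)
    have fst: "continuous_on (L \<times> L) (\<lambda>v. f (fst v))"
      by (rule continuous_on_compose2[OF cont]) (auto intro!: continuous_intros)
    have snd: "continuous_on (L \<times> L) (\<lambda>v. f (snd v))"
      by (rule continuous_on_compose2[OF cont]) (auto intro!: continuous_intros)
    have "continuous_on (L \<times> L) (h1 f)" "continuous_on (L \<times> L) (h2 f)"
      unfolding h1_h2_def by (intro continuous_intros fst snd; simp)+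
    then have "continuous_map K euclidean (T f)"
      unfolding T_def by (intro continuous_map_add ext_opD(1)[OF S1] ext_opD(1)[OF S2])
    moreover have "T f k = 0" if "k \<notin> topspace K" for k
    proof -
      have "k \<notin> U1" "k \<notin> U2"
        using that U(2,3) by auto
      then show ?thesis
        by (simp add: T_def ext_opD(2)[OF S1] ext_opD(2)[OF S2])
    qed
    ultimately show ?thesis
      by (simp add: C_space_def)
  qed
  have T_add: "T (\<lambda>x. f x + g x) = (\<lambda>k. T f k + T g k)" for f g
  proof -
    have "h1 (\<lambda>x. f x + g x) = (\<lambda>v. h1 f v + h1 g v)" "h2 (\<lambda>x. f x + g x) = (\<lambda>v. h2 f v + h2 g v)"
      by (auto simp: h1_h2_def fun_eq_iff field_simps)
    then show ?thesis
      unfolding T_def by (simp add: ext_opD(3)[OF S1] ext_opD(3)[OF S2] ac_simps)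
  qed
  have T_scale: "T (\<lambda>x. c * f x) = (\<lambda>k. c * T f k)" for c f
  proof -
    have "h1 (\<lambda>x. c * f x) = (\<lambda>v. c * h1 f v)" "h2 (\<lambda>x. c * f x) = (\<lambda>v. c * h2 f v)"
      by (auto simp: h1_h2_def fun_eq_iff field_simps)
    then show ?thesis
      unfolding T_def by (simp add: ext_opD(4)[OF S1] ext_opD(4)[OF S2] distrib_left)
  qed
  have ex1: "\<exists>k. \<forall>f. T f k = (f b + f c) / 2" if bc: "b \<in> L" "c \<in> L" for b c
  proof -
    obtain k where "k \<in> U1" "\<forall>h. S1 h k = h (b, c)"
      using ext_opD(6)[OF S1 SigmaI[OF bc]] by blast
    then show ?thesis
      by (intro exI[of _ k]) (simp add: T_U1 h1_h2_def)
  qed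
  have ex2: "\<exists>k. \<forall>f. T f k = (f b + \<i> * f c) / 2" if bc: "b \<in> L" "c \<in> L" for b c
  proof -
    obtain k where "k \<in> U2" "\<forall>h. S2 h k = h (b, c)"
      using ext_opD(6)[OF S2 SigmaI[OF bc]] by blast
    moreover from this have "k \<notin> U1" using U(1) by blast
    ultimately show ?thesis
      by (intro exI[of _ k]) (simp add: T_notU1 h1_h2_def)
  qed
  have norm_T: "sup_norm K (T f) = sup_norm ?X f" if f: "f \<in> C_space ?X" for f
  proof (rule antisym)
    have le: "cmod (f x) \<le> sup_norm ?X f" for x
      by (rule cmod_le_sup_norm[OF X f])
    have "cmod (h1 f v) \<le> sup_norm ?X f" for v
      using norm_triangle_ineq[of "f (fst v)" "f (snd v)"] le[of "fst v"] le[of "snd v"]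
      by (simp add: h1_h2_def norm_divide)
    moreover have "cmod (h2 f v) \<le> sup_norm ?X f" for v
      using norm_triangle_ineq[of "f (fst v)" "\<i> * f (snd v)"] le[of "fst v"] le[of "snd v"]
      by (simp add: h1_h2_def norm_divide norm_mult)
    ultimately have "cmod (T f k) \<le> sup_norm ?X f" for k
      using ext_opD(5)[OF S1, of 0 "sup_norm ?X f" "h1 f" k] ext_opD(5)[OF S2, of 0 "sup_norm ?X f" "h2 f" k]
        sup_norm_nonneg[OF X f] by (cases "k \<in> U1") (auto simp: T_U1 T_notU1)
    then show "sup_norm K (T f) \<le> sup_norm ?X f"
      by (rule sup_norm_le[OF sup_norm_nonneg[OF X f]])
    show "sup_norm ?X f \<le> sup_norm K (T f)"
    proof (rule sup_norm_le[OF sup_norm_nonneg[OF K T_C[OF f]]])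
      fix x
      assume "x \<in> topspace ?X"
      then obtain k where "\<forall>f. T f k = (f x + f x) / 2"
        using ex1[of x x] by auto
      then show "cmod (f x) \<le> sup_norm K (T f)"
        using cmod_le_sup_norm[OF K T_C[OF f], of k] by simp
    qed
  qed
  have "linear_isometric_embedding ?X K T"
    unfolding linear_isometric_embedding_def using T_C norm_T T_add T_scale by blast
  moreover have "C_subspace K (T ` C_space ?X)"
  proof -
    have zero: "(\<lambda>x. 0) \<in> C_space ?X"
      by (simp add: C_space_def)
    have "T (\<lambda>x. 0) = (\<lambda>x. 0)"
      using T_scale[of 0 "\<lambda>x. 0"] by simp
    then have "(\<lambda>x. 0) \<in> T ` C_space ?X"
      using zero by (metis imageI)
    moreover have "(\<lambda>k. T f k + T g k) \<in> T ` C_space ?X" if "f \<in> C_space ?X" "g \<in> C_space ?X" for f g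
      using imageI[OF C_space_add[OF that], of T] by (simp only: T_add)
    moreover have "(\<lambda>k. c * T f k) \<in> T ` C_space ?X" if "f \<in> C_space ?X" for c f
      using imageI[OF C_space_scale[OF that], of T] by (simp only: T_scale)
    ultimately show ?thesis
      unfolding C_subspace_def using T_C by auto
  qed
  moreover have "(INF l\<in>{l. cmod l = 1}. sup_norm K (\<lambda>x. T f x - l * T g x))
      \<le> 18 * sup_norm K (\<lambda>x. complex_of_real (cmod (T f x) - cmod (T g x)))"
    if f: "f \<in> C_space ?X" and g: "g \<in> C_space ?X" for f g
  proof -
    \<comment> \<open>Differences are again values of \<open>T\<close>, so by isometry the distance
      can be estimated on \<open>L\<close>.\<close>
    have T_diff: "(\<lambda>x. T f x - l * T g x) = T (\<lambda>x. f x + (- l) * g x)"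
      and diff_C: "(\<lambda>x. f x + (- l) * g x) \<in> C_space ?X" for l
      using C_space_add[OF f C_space_scale[OF g, of "- l"]] T_add[of f "\<lambda>x. (- l) * g x"]
        T_scale[of "- l" g] by simp_all
    let ?m = "\<lambda>x. complex_of_real (cmod (T f x) - cmod (T g x))"
    define d where "d = sup_norm K ?m"
    have "(\<lambda>x. complex_of_real (cmod (T f x)) + (- 1) * complex_of_real (cmod (T g x))) \<in> C_space K"
      by (intro C_space_add C_space_scale C_space_cmod T_C f g)
    then have m: "?m \<in> C_space K" by simp
    have d: "\<bar>cmod (T f k) - cmod (T g k)\<bar> \<le> d" for k
      using cmod_le_sup_norm[OF K m, of k] unfolding d_def norm_of_real .
    have avg: "\<bar>cmod (f b + f c) - cmod (g b + g c)\<bar> \<le> 2 * d" if bc: "b \<in> L" "c \<in> L" for b c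
    proof -
      obtain k where k: "\<forall>f. T f k = (f b + f c) / 2"
        using ex1[OF bc] by blast
      have T_k: "cmod (T u k) = cmod (u b + u c) / 2" for u
        by (simp only: k[rule_format] norm_divide norm_numeral)
      show ?thesis
        using d[of k] unfolding T_k by linarith
    qed
    have avg_i: "\<bar>cmod (f b + \<i> * f c) - cmod (g b + \<i> * g c)\<bar> \<le> 2 * d" if bc: "b \<in> L" "c \<in> L" for b c
    proof -
      obtain k where k: "\<forall>f. T f k = (f b + \<i> * f c) / 2"
        using ex2[OF bc] by blast
      have T_k: "cmod (T u k) = cmod (u b + \<i> * u c) / 2" for u
        by (simp only: k[rule_format] norm_divide norm_numeral)
      show ?thesis
        using d[of k] unfolding T_k by linarith
    qed
    have "continuous_on L (\<lambda>x. cmod (f x))"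
      using f by (auto simp: C_space_def intro!: continuous_intros)
    then obtain a where a: "a \<in> L" "\<And>x. x \<in> L \<Longrightarrow> cmod (f x) \<le> cmod (f a)"
      using continuous_attains_sup[OF L] by blast
    have "\<bar>cmod (f x) - cmod (g x)\<bar> \<le> d" if "x \<in> L" for x
    proof -
      have "cmod (f x + f x) = 2 * cmod (f x)" "cmod (g x + g x) = 2 * cmod (g x)"
        by (simp_all add: norm_mult flip: mult_2)
      then show ?thesis
        using avg[OF that that] by simp
    qed
    then obtain l where l: "cmod l = 1" "\<And>x. x \<in> L \<Longrightarrow> cmod (f x - l * g x) \<le> 18 * d"
      using phase_recovery[of a L f g d] a avg[OF a(1)] avg_i[OF a(1)] by blast
    have "(INF l\<in>{l. cmod l = 1}. sup_norm K (\<lambda>x. T f x - l * T g x))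
        \<le> sup_norm K (\<lambda>x. T f x - l * T g x)"
    proof (rule cINF_lower)
      show "bdd_below ((\<lambda>l. sup_norm K (\<lambda>x. T f x - l * T g x)) ` {l. cmod l = 1})"
        unfolding T_diff using sup_norm_nonneg[OF K T_C[OF diff_C]] by (intro bdd_belowI[of _ 0]) auto
    qed (use l(1) in simp)
    also have "\<dots> = sup_norm ?X (\<lambda>x. f x + (- l) * g x)"
      unfolding T_diff by (rule norm_T[OF diff_C])
    also have "\<dots> \<le> 18 * d"
      using l(2) sup_norm_nonneg[OF K m] by (intro sup_norm_le) (auto simp: d_def)
    finally show ?thesis
      unfolding d_def .
  qed
  ultimately show ?thesis
    unfolding does_SPR_def by (intro exI[of _ T]) auto
qed

theorem theorem3p7:
  "\<exists>C::real. 1 \<le> C \<and> C \<le> SPR_bound \<and>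
     (\<forall>(K :: 'a topology) (\<alpha> :: cord).
        compact_space K \<longrightarrow> Hausdorff_space K \<longrightarrow>
        (\<exists>x \<in> CB_derivative K (nat_double \<alpha>). \<exists>y \<in> CB_derivative K (nat_double \<alpha>). x \<noteq> y) \<longrightarrow>
        (\<exists>T. linear_isometric_embedding (ord_interval \<alpha>) K T \<and>
             does_SPR C K (T ` C_space (ord_interval \<alpha>))))"
proof (rule exI[of _ 18], intro conjI allI impI)
  fix K :: "'a topology" and \<alpha> :: cord
  let ?L = "{1..omega_pow \<alpha>}"
  assume K: "compact_space K" "Hausdorff_space K"
    and "\<exists>x \<in> CB_derivative K (nat_double \<alpha>). \<exists>y \<in> CB_derivative K (nat_double \<alpha>). x \<noteq> y"
  then obtain x y where xy: "x \<in> CB_derivative K (nat_double \<alpha>)"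
      "y \<in> CB_derivative K (nat_double \<alpha>)" "x \<noteq> y"
    by blast
  then have "x \<in> topspace K" "y \<in> topspace K"
    using CB_derivative_antimono[OF zero_le_cord, of K "nat_double \<alpha>"]
    by (auto simp: CB_derivative_simps)
  then obtain U1 U2 where U: "openin K U1" "openin K U2" "x \<in> U1" "y \<in> U2" "disjnt U1 U2"
    using K(2) xy(3) unfolding Hausdorff_space_def by blast
  obtain S1 where S1: "ext_op K (?L \<times> ?L) U1 S1"
    using ext_op_square[OF K xy(1) U(1,3)] by blast
  obtain S2 where S2: "ext_op K (?L \<times> ?L) U2 S2"
    using ext_op_square[OF K xy(2) U(2,4)] by blast
  have "?L \<noteq> {}"
    using omega_pow_neq_zero one_le_cord_iff by auto
  then show "\<exists>T. linear_isometric_embedding (ord_interval \<alpha>) K T \<and>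
      does_SPR 18 K (T ` C_space (ord_interval \<alpha>))"
    unfolding ord_interval_def using U
    by (intro spr_embedding[OF K(1) _ _ S1 S2])
       (auto simp: one_atLeastAtMost_cord compact_greaterThanAtMost_cord disjnt_def openin_subset)
qed (simp_all add: SPR_bound_def)

end
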